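(* Consider the General-Label-Model with label set $[N]$, and let $\varepsilon>0$ be sufficiently small. Consider any $(\varepsilon, T(d,\varepsilon), \ell(n,d,\varepsilon))$-partition oracle (with $d=2$) that works for all $n$-cycles with $n \le N$. Then the seed length satisfies $\ell(n,d,\varepsilon) = \omega_N(1)$, i.e., it cannot be bounded by a constant independent of $N$.
   Context: General-Label-Model: the input graph has $n$ vertices and maximum degree at most $d$; each vertex $v$ carries a distinct label $\ell(v)\in[N]$, where $N$ is known to the algorithm, as are $n$ and $d$ (with $n = g^{-1}(N)\ll N$ for a sufficiently slowly growing function $g$). The algorithm has two kinds of queries: label queries (given $i\in[n]$, return the label of the $i$-th vertex in an arbitrary fixed order of the vertices) and neighbor queries (given a vertex label and $r\le d$, return the label of the $r$-th neighbor of that vertex). An $(\varepsilon, T(d,\varepsilon), \ell(n,d,\varepsilon))$-partition oracle in this model takes query access to $G$, a uniform random seed $r$ of length $\ell(n,d,\varepsilon)$, $\varepsilon>0$ and a vertex (label) $v$, outputs a set $\boldsymbol{A}_{G,r,\varepsilon}(v)$ of vertices, and satisfies: (1) for every seed the output sets over all vertices form a partition of the vertex set into sets each inducing a connected subgraph; (2) with probability at least $2/3$ over the seed, at most $\varepsilon d n$ edges cross the partition; (3) each call makes at most $T(d,\varepsilon)$ queries. *)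

theory Defs
  imports
    "HOL-Probability.Probability_Mass_Function"
    "HOL-Library.Landau_Symbols"
    "HOL-Library.Disjoint_Sets"
begin

text \<open>
  Since the labels are distinct, a vertex is identified with its label. The list \<open>vlist G\<close> is the
  arbitrary fixed order of the vertices, and \<open>nbrs G v\<close> lists the neighbors of \<open>v\<close> in the order in
  which neighbor queries reveal them. All positions are counted from 1, and \<open>[N]\<close> is \<open>{1..N}\<close>.
\<close>

record lgraph =
  vlist :: "nat list"
  nbrs :: "nat \<Rightarrow> nat list"

definition verts :: "lgraph \<Rightarrow> nat set" where
  "verts G = set (vlist G)"

definition edges :: "lgraph \<Rightarrow> nat set set" where
  "edges G = {{u, v} | u v. u \<in> verts G \<and> v \<in> set (nbrs G u)}"

definition general_label_graph :: "nat \<Rightarrow> nat \<Rightarrow> nat \<Rightarrow> lgraph \<Rightarrow> bool" where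
  "general_label_graph N n d G \<longleftrightarrow>
     length (vlist G) = n \<and> distinct (vlist G) \<and> verts G \<subseteq> {1..N} \<and>
     (\<forall>v \<in> verts G. distinct (nbrs G v) \<and> length (nbrs G v) \<le> d \<and>
        set (nbrs G v) \<subseteq> verts G - {v} \<and>
        (\<forall>u \<in> set (nbrs G v). v \<in> set (nbrs G u)))"

definition is_cycle :: "lgraph \<Rightarrow> bool" where
  "is_cycle G \<longleftrightarrow>
     (let n = card (verts G) in
      n \<ge> 3 \<and>
      (\<exists>c. bij_betw c {..<n} (verts G) \<and>
           edges G = {{c i, c (Suc i mod n)} | i. i < n}))"

definition label_cycles :: "nat \<Rightarrow> nat \<Rightarrow> lgraph set" where
  "label_cycles N n = {G. general_label_graph N n 2 G \<and> is_cycle G}"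

definition induces_connected :: "lgraph \<Rightarrow> nat set \<Rightarrow> bool" where
  "induces_connected G S \<longleftrightarrow>
     S \<noteq> {} \<and> S \<subseteq> verts G \<and>
     (\<forall>u \<in> S. \<forall>v \<in> S. (u, v) \<in> {(x, y). x \<in> S \<and> y \<in> S \<and> {x, y} \<in> edges G}\<^sup>*)"

definition crossing_edges :: "lgraph \<Rightarrow> nat set set \<Rightarrow> nat set set" where
  "crossing_edges G P = {e \<in> edges G. \<not> (\<exists>B \<in> P. e \<subseteq> B)}"

text \<open>
  An adaptive deterministic query algorithm is a decision tree. A query that asks for something that
  does not exist (position out of range, label not occurring in the graph, neighbor number exceeding
  the degree) is answered by \<open>None\<close>; it is counted like any other query.
\<close>

datatype query_alg =
    Output "nat set"
  | Label_Query nat "nat option \<Rightarrow> query_alg"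
  | Neighbor_Query nat nat "nat option \<Rightarrow> query_alg"

definition label_answer :: "lgraph \<Rightarrow> nat \<Rightarrow> nat option" where
  "label_answer G i =
     (if 1 \<le> i \<and> i \<le> length (vlist G) then Some (vlist G ! (i - 1)) else None)"

definition neighbor_answer :: "lgraph \<Rightarrow> nat \<Rightarrow> nat \<Rightarrow> nat option" where
  "neighbor_answer G v j =
     (if v \<in> verts G \<and> 1 \<le> j \<and> j \<le> length (nbrs G v) then Some (nbrs G v ! (j - 1)) else None)"

primrec run :: "lgraph \<Rightarrow> query_alg \<Rightarrow> nat set" where
  "run G (Output S) = S"
| "run G (Label_Query i k) = run G (k (label_answer G i))"
| "run G (Neighbor_Query v j k) = run G (k (neighbor_answer G v j))"

primrec num_queries :: "lgraph \<Rightarrow> query_alg \<Rightarrow> nat" where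
  "num_queries G (Output S) = 0"
| "num_queries G (Label_Query i k) = Suc (num_queries G (k (label_answer G i)))"
| "num_queries G (Neighbor_Query v j k) = Suc (num_queries G (k (neighbor_answer G v j)))"

text \<open>
  A seeded algorithm maps a seed and the queried vertex to a query algorithm. The parameters known to it
  (such as \<open>N\<close>, \<open>n\<close>, \<open>d\<close>, \<open>\<epsilon>\<close>) are handled by considering families of such algorithms indexed by them.
\<close>

type_synonym seeded_alg = "bool list \<Rightarrow> nat \<Rightarrow> query_alg"

definition oracle_parts :: "seeded_alg \<Rightarrow> lgraph \<Rightarrow> bool list \<Rightarrow> nat set set" where
  "oracle_parts A G r = (\<lambda>v. run G (A r v)) ` verts G"

definition seeds :: "nat \<Rightarrow> bool list set" where
  "seeds l = {r. length r = l}"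

definition partition_oracle ::
    "lgraph set \<Rightarrow> nat \<Rightarrow> real \<Rightarrow> nat \<Rightarrow> nat \<Rightarrow> seeded_alg \<Rightarrow> bool" where
  "partition_oracle \<G> d \<epsilon> T l A \<longleftrightarrow>
     (\<forall>G \<in> \<G>.
        (\<forall>r \<in> seeds l.
           partition_on (verts G) (oracle_parts A G r) \<and>
           (\<forall>B \<in> oracle_parts A G r. induces_connected G B)) \<and>
        measure_pmf.prob (pmf_of_set (seeds l))
          {r. real (card (crossing_edges G (oracle_parts A G r)))
                \<le> \<epsilon> * real d * real (card (verts G))} \<ge> 2 / 3 \<and>
        (\<forall>r \<in> seeds l. \<forall>v \<in> verts G. num_queries G (A r v) \<le> T))"

end

(* Ramsey's theorem yields a large set of labels on which the decision trees of all seeds depend only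
   on the relative order of the labels seen so far. Using only every other label of that set, no tree
   can mention a label it has not seen: moving that label to the unused one next to it would not
   change what has been seen. Hence only a number of label queries bounded in terms of the seed
   length and the number of queries ever occurs. Put the vertices they reveal on one short arc of a
   cycle whose labels increase along the cycle. Away from that arc the output at the next vertex is
   the translate of the output at the current vertex. Parts are disjoint or equal, so either these
   outputs are all the same set, which leaves too few parts of bounded size to cover the cycle, or
   they are all singletons, and nearly every edge crosses. The one cycle defeats every seed. *)

theory Submission
  imports Defs "HOL-Library.Ramsey" "HOL-Real_Asymp.Real_Asymp"
begin

section \<open>Homogeneous label sets\<close>

text \<open>The order of choices shapes the proof. The threshold on \<open>N\<close> has to come
  from \<open>n\<close>, the query bound and the seed length alone, so that \<open>h\<^sub>0\<close>
  can be fixed before any oracle is given; the set of colours may therefore depend on nothing else.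
  So trees are evaluated on all answer lists, with labels replaced by their ranks, and a colour
  keeps the kind and number of the query reached and which of \<open>T + 2\<close> labels it
  mentions: room for the start, \<open>T\<close> answers and one label not seen so far. The bound on
  label queries must not grow with \<open>n\<close>, or the arc that they reveal could fill the
  cycle. Counting patterns achieves this: all label sets that realise a pattern ask for the same
  list position. The graph is chosen only after these positions are known, and the order of its
  vertex list is a free parameter. The parts returned need not contain the vertex asked about.
  Translated outputs may thus sit beside the moving vertex, or on the fixed arc, and the latter case
  has to be excluded by counting.\<close>

definition increasing_maps :: "nat \<Rightarrow> nat \<Rightarrow> (nat \<Rightarrow> nat) set" where
  "increasing_maps k M = {e. strict_mono_on {..<k} e \<and> e ` {..<k} \<subseteq> {..<M}}"

text \<open>A \<open>k\<close>-subset of \<open>{..<N}\<close> is coloured by the value of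
  \<open>f\<close> at its increasing enumeration. The threshold comes before \<open>f\<close> and
  \<open>C\<close> and depends on the number of colours only, which later makes it uniform over all
  algorithms.\<close>

lemma ramsey_increasing:
  fixes k M q :: nat
  shows "\<exists>N\<^sub>0. \<forall>N\<ge>N\<^sub>0. \<forall>(f :: (nat \<Rightarrow> nat) \<Rightarrow> 'c) C.
    finite C \<longrightarrow> card C \<le> q \<longrightarrow> range f \<subseteq> C \<longrightarrow>
    (\<forall>e e'. (\<forall>p<k. e p = e' p) \<longrightarrow> f e = f e') \<longrightarrow>
    (\<exists>h. strict_mono_on {..<M} h \<and> h ` {..<M} \<subseteq> {1..N} \<and>
      (\<forall>e\<in>increasing_maps k M. \<forall>e'\<in>increasing_maps k M. f (h \<circ> e) = f (h \<circ> e')))"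
proof -
  obtain N\<^sub>0 :: nat where N0: "partn_lst {..<N\<^sub>0} (replicate q M) k"
    using ramsey_full[of "replicate q M" k] by blast
  show ?thesis
  proof (intro exI[of _ N\<^sub>0] allI impI)
    fix N and f :: "(nat \<Rightarrow> nat) \<Rightarrow> 'c" and C
    assume "N \<ge> N\<^sub>0" and C: "finite C" "card C \<le> q" "range f \<subseteq> C"
      and cong: "\<forall>e e'. (\<forall>p<k. e p = e' p) \<longrightarrow> f e = f e'"
    obtain num where "bij_betw num C {0..<card C}"
      using ex_bij_betw_finite_nat[OF C(1)] by blast
    then have num: "inj_on num C" "num ` C \<subseteq> {..<q}"
      using C(2) by (auto simp: bij_betw_def)
    have f_C: "f e \<in> C" for e
      using C(3) by auto
    then have less_q: "num (f e) < q" for e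
      using num(2) by auto
    \<comment> \<open>Ramsey's theorem works on \<open>{..<N}\<close>, labels live in
      \<open>{1..N}\<close>; \<open>Suc\<close> translates.\<close>
    define enum where "enum X p = Suc (sorted_list_of_set X ! p)" for X :: "nat set" and p
    have "partn_lst {..<N} (replicate q M) k"
      using N0 \<open>N \<ge> N\<^sub>0\<close> by (rule partn_lst_greater_resource)
    moreover have "(\<lambda>X. num (f (enum X))) \<in> [{..<N}]\<^bsup>k\<^esup> \<rightarrow> {..<q}"
      using less_q by (intro Pi_I) simp
    ultimately obtain i H where i: "i < q" and H: "H \<in> [{..<N}]\<^bsup>M\<^esup>"
      and hom: "(\<lambda>X. num (f (enum X))) ` [H]\<^bsup>k\<^esup> \<subseteq> {i}"
      by (rule partn_lstE) auto
    have H': "finite H" "card H = M" "H \<subseteq> {..<N}" using H by (auto simp: nsets_def)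
    let ?hs = "sorted_list_of_set H"
    have hs: "sorted_wrt (<) ?hs" "set ?hs = H" "length ?hs = M"
      using H' by auto
    have mono: "strict_mono_on {..<M} ((!) ?hs)"
      using hs by (auto simp: strict_mono_on_def sorted_wrt_iff_nth_less)
    have inH: "?hs ! p \<in> H" if "p < M" for p
      using that hs by (metis nth_mem)
    \<comment> \<open>On \<open>{..<k}\<close>, \<open>enum H \<circ> e\<close> is the increasing
      enumeration of a \<open>k\<close>-subset of \<open>H\<close>. The two functions may differ
      elsewhere, which is where \<open>cong\<close> enters.\<close>
    have main: "num (f (enum H \<circ> e)) = i"
      if e: "strict_mono_on {..<k} e" "e ` {..<k} \<subseteq> {..<M}" for e
    proof -
      let ?X = "(\<lambda>p. ?hs ! e p) ` {..<k}"
      have m: "strict_mono_on {..<k} (\<lambda>p. ?hs ! e p)"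
        using e mono by (auto simp: strict_mono_on_def image_subset_iff)
      have X: "?X \<in> [H]\<^bsup>k\<^esup>"
        using inH e card_image[OF strict_mono_on_imp_inj_on[OF m]] by (auto simp: nsets_def)
      have "sorted_list_of_set ?X = map (\<lambda>p. ?hs ! e p) [0..<k]"
      proof -
        have "sorted_wrt (<) (map (\<lambda>p. ?hs ! e p) [0..<k])"
          using m by (auto simp: sorted_wrt_iff_nth_less strict_mono_on_def)
        then show ?thesis
          using sorted_list_of_set.idem_if_sorted_distinct[of "map (\<lambda>p. ?hs ! e p) [0..<k]"]
          by (simp add: strict_sorted_iff atLeast0LessThan)
      qed
      then have "f (enum H \<circ> e) = f (enum ?X)"
        using cong by (auto simp: enum_def)
      then show ?thesis using hom X by auto
    qed
    show "\<exists>h. strict_mono_on {..<M} h \<and> h ` {..<M} \<subseteq> {1..N} \<and>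
      (\<forall>e\<in>increasing_maps k M. \<forall>e'\<in>increasing_maps k M. f (h \<circ> e) = f (h \<circ> e'))"
    proof (intro exI[of _ "enum H"] conjI ballI)
      show "strict_mono_on {..<M} (enum H)"
        using mono by (auto simp: strict_mono_on_def enum_def)
      show "enum H ` {..<M} \<subseteq> {1..N}"
        unfolding enum_def using inH H'(3) by (force simp: Suc_le_eq)
      fix e e'
      assume "e \<in> increasing_maps k M" "e' \<in> increasing_maps k M"
      then have "num (f (enum H \<circ> e)) = num (f (enum H \<circ> e'))"
        using main by (simp add: increasing_maps_def)
      then show "f (enum H \<circ> e) = f (enum H \<circ> e')"
        using num(1) f_C by (auto dest: inj_onD)
    qed
  qed
qed

text \<open>The answers are prescribed and come from no graph, since homogeneity has to be
  established before the graph is built.\<close>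

fun follow :: "query_alg \<Rightarrow> nat option list \<Rightarrow> query_alg" where
  "follow a [] = a"
| "follow (Output S) (x # xs) = Output S"
| "follow (Label_Query i k) (x # xs) = follow (k x) xs"
| "follow (Neighbor_Query v j k) (x # xs) = follow (k x) xs"

lemma follow_snoc: "follow a (xs @ [x]) = follow (follow a xs) [x]"
  by (induction a xs rule: follow.induct) auto

text \<open>
  Query numbers are unbounded, but those out of range are all answered by \<open>None\<close>. Identifying them
  with \<open>0\<close> makes the number of colours finite.
\<close>

definition clip :: "nat \<Rightarrow> nat \<Rightarrow> nat" where
  "clip m i = (if i \<le> m then i else 0)"

text \<open>The label in a neighbor query is left out because labels are not bounded independently
  of \<open>N\<close>; \<open>view\<close> records it relative to known labels through
  \<open>labels\<close>.\<close>

fun shape :: "nat \<Rightarrow> query_alg \<Rightarrow> nat \<times> nat" where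
  "shape n (Output S) = (0, 0)"
| "shape n (Label_Query i k) = (1, clip n i)"
| "shape n (Neighbor_Query v j k) = (2, clip 2 j)"

fun labels :: "query_alg \<Rightarrow> nat set" where
  "labels (Output S) = S"
| "labels (Label_Query i k) = {}"
| "labels (Neighbor_Query v j k) = {v}"

text \<open>The start and the answers are ranks within an increasing list of \<open>T + 2\<close>
  labels, so the number of patterns does not involve \<open>n\<close> or \<open>N\<close>.\<close>

definition patterns :: "nat \<Rightarrow> nat \<Rightarrow> (bool list \<times> nat \<times> nat option list) set" where
  "patterns l T = seeds l \<times> {..<T + 2} \<times> {L. set L \<subseteq> insert None (Some ` {..<T + 2}) \<and> length L \<le> T}"

text \<open>The list \<open>e\<close> realises the ranks of a pattern by labels. The result is all
  that is remembered of the node reached, and serves as the colour.\<close>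

definition view :: "nat \<Rightarrow> nat \<Rightarrow> seeded_alg \<Rightarrow> (nat \<Rightarrow> nat) \<Rightarrow>
    bool list \<times> nat \<times> nat option list \<Rightarrow> (nat \<times> nat) \<times> nat set" where
  "view n T A e = (\<lambda>(r, p, L). let a = follow (A r (e p)) (map (map_option e) L) in
     (shape n a, {q. q < T + 2 \<and> e q \<in> labels a}))"

lemma finite_seeds: "finite (seeds l)"
  using finite_lists_length_eq[of "UNIV :: bool set" l] by (simp add: seeds_def)

lemma seeds_nonempty: "seeds l \<noteq> {}"
  by (auto simp: seeds_def intro: exI[of _ "replicate l True"])

lemma finite_patterns: "finite (patterns l T)"
  unfolding patterns_def by (intro finite_cartesian_product finite_seeds finite_lists_length_le) auto

lemma view_cong:
  assumes "\<And>p. p < T + 2 \<Longrightarrow> e p = e' p" and "x \<in> patterns l T"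
  shows "view n T A e x = view n T A e' x"
proof -
  obtain r p L where x: "x = (r, p, L)" by (cases x)
  have L: "map (map_option e) L = map (map_option e') L"
    using assms x by (fastforce simp: patterns_def intro!: option.map_cong)
  have "e p = e' p"
    using assms x by (simp add: patterns_def)
  then show ?thesis
    unfolding view_def x Let_def case_prod_conv L using assms(1) by auto
qed

lemma view_range: "view n T A e x \<in> ({..2} \<times> {..n + 2}) \<times> Pow {..<T + 2}"
proof -
  obtain r p L where x: "x = (r, p, L)" by (cases x)
  have "shape n a \<in> {..2} \<times> {..n + 2}" for a
    by (cases a) (auto simp: clip_def)
  then show ?thesis by (auto simp: view_def x Let_def)
qed

locale order_invariant =
  fixes n T l :: nat and A :: seeded_alg and h :: "nat \<Rightarrow> nat"
  assumes h_mono: "strict_mono_on {..<2 * n + T + 2} h"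
    and hom: "\<lbrakk>e \<in> increasing_maps (T + 2) (2 * n + T + 2); e' \<in> increasing_maps (T + 2) (2 * n + T + 2);
      x \<in> patterns l T\<rbrakk> \<Longrightarrow>
      view n T A (h \<circ> e) x = view n T A (h \<circ> e') x"

text \<open>The colour is the whole function \<open>view n T A e\<close> on patterns, so one use of
  Ramsey's theorem handles all seeds and all answer lists together.\<close>

lemma ex_order_invariant:
  "\<exists>N\<^sub>0. \<forall>N\<ge>N\<^sub>0. \<forall>A. \<exists>h. h ` {..<2 * n + T + 2} \<subseteq> {1..N} \<and> order_invariant n T l A h"
proof -
  define C where "C = patterns l T \<rightarrow>\<^sub>E ({..2::nat} \<times> {..n + 2}) \<times> Pow {..<T + 2}"
  have fin: "finite C" unfolding C_def by (intro finite_PiE finite_patterns) auto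
  define k M where "k = T + 2" and "M = 2 * n + T + 2"
  obtain N\<^sub>0 where N0: "\<forall>N\<ge>N\<^sub>0. \<forall>(f :: (nat \<Rightarrow> nat) \<Rightarrow> bool list \<times> nat \<times> nat option list \<Rightarrow> (nat \<times> nat) \<times> nat set) C'.
    finite C' \<longrightarrow> card C' \<le> card C \<longrightarrow> range f \<subseteq> C' \<longrightarrow>
    (\<forall>e e'. (\<forall>p<k. e p = e' p) \<longrightarrow> f e = f e') \<longrightarrow>
    (\<exists>h. strict_mono_on {..<M} h \<and> h ` {..<M} \<subseteq> {1..N} \<and>
      (\<forall>e\<in>increasing_maps k M. \<forall>e'\<in>increasing_maps k M. f (h \<circ> e) = f (h \<circ> e')))"
    using ramsey_increasing[of "card C" k M] by (rule exE)
  show ?thesis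
  proof (intro exI[of _ N\<^sub>0] allI impI)
    fix N and A :: seeded_alg
    assume N: "N \<ge> N\<^sub>0"
    define f where "f e = restrict (view n T A e) (patterns l T)" for e
    have range: "range f \<subseteq> C"
      unfolding f_def C_def by (intro image_subsetI iffD2[OF restrict_PiE_iff] ballI view_range)
    have cong: "\<forall>e e'. (\<forall>p<k. e p = e' p) \<longrightarrow> f e = f e'"
      unfolding f_def by (intro allI impI restrict_ext view_cong) (simp_all add: k_def)
    obtain h where h: "strict_mono_on {..<M} h" "h ` {..<M} \<subseteq> {1..N}"
      "\<forall>e\<in>increasing_maps k M. \<forall>e'\<in>increasing_maps k M. f (h \<circ> e) = f (h \<circ> e')"
      using N0[THEN spec, THEN mp, OF N, THEN spec, THEN spec, THEN mp, OF fin, THEN mp, OF order.refl,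
          THEN mp, OF range, THEN mp, OF cong] by blast
    have "order_invariant n T l A h"
    proof
      show "strict_mono_on {..<2 * n + T + 2} h" using h(1) by (simp add: M_def)
      fix e e' x
      assume "e \<in> increasing_maps (T + 2) (2 * n + T + 2)" "e' \<in> increasing_maps (T + 2) (2 * n + T + 2)"
        and x: "x \<in> patterns l T"
      then have "f (h \<circ> e) = f (h \<circ> e')" using h(3) unfolding k_def M_def by blast
      then show "view n T A (h \<circ> e) x = view n T A (h \<circ> e') x"
        using x unfolding f_def by (metis restrict_apply')
    qed
    with h(2) show "\<exists>h. h ` {..<2 * n + T + 2} \<subseteq> {1..N} \<and> order_invariant n T l A h"
      unfolding M_def by blast
  qed
qed

section \<open>Consequences of homogeneity for single histories\<close>

context order_invariant
begin

definition history :: "bool list \<Rightarrow> nat \<Rightarrow> nat option list \<Rightarrow> query_alg" where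
  "history r x L = follow (A r (h x)) (map (map_option h) L)"

text \<open>Here each rank is realised by the index equal to it; by homogeneity this one realisation
  stands for all. The value \<open>0\<close> is excluded because \<open>clip\<close> uses it for
  positions out of range.\<close>

definition landmarks :: "nat set" where
  "landmarks = {i. 1 \<le> i \<and> (\<exists>(r, p, L) \<in> patterns l T. shape n (history r p L) = (1, i))}"

lemma card_landmarks: "finite landmarks" "card landmarks \<le> card (patterns l T)"
proof -
  have "landmarks \<subseteq> (\<lambda>(r, p, L). snd (shape n (history r p L))) ` patterns l T"
    by (force simp: landmarks_def)
  then show "finite landmarks" "card landmarks \<le> card (patterns l T)"
    using finite_patterns[of l T] by (auto intro: finite_subset surj_card_le)
qed

lemma landmarks_range: "landmarks \<subseteq> {1..n}"
proof -
  have "i \<le> n" if "shape n a = (1, i)" for a i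
    using that by (cases a) (auto simp: clip_def split: if_splits)
  then show ?thesis by (auto simp: landmarks_def)
qed

text \<open>Both \<open>E\<close> and its image are enumerated increasingly and padded to length
  \<open>T + 2\<close> by the indices \<open>2 * n + p\<close>, which exceed everything in either
  set. Then \<open>x\<close> and \<open>\<phi> x\<close> have the same rank
  \<open>g x\<close>.\<close>

lemma embed:
  assumes E: "E \<subseteq> {..<2 * n}" "card E \<le> T + 2"
    and \<phi>: "strict_mono_on E \<phi>" "\<phi> ` E \<subseteq> {..<2 * n}"
  shows "\<exists>e \<in> increasing_maps (T + 2) (2 * n + T + 2). \<exists>e' \<in> increasing_maps (T + 2) (2 * n + T + 2).
    \<exists>g. \<forall>x \<in> E. g x < T + 2 \<and> e (g x) = x \<and> e' (g x) = \<phi> x"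
proof -
  let ?es = "sorted_list_of_set E"
  have fin: "finite E" using E(1) finite_subset by blast
  then have es: "sorted_wrt (<) ?es" "set ?es = E" "length ?es = card E" by auto
  define e where "e p = (if p < card E then ?es ! p else 2 * n + p)" for p
  define e' where "e' p = (if p < card E then \<phi> (?es ! p) else 2 * n + p)" for p
  define g where "g x = (SOME p. p < card E \<and> ?es ! p = x)" for x
  have mem: "?es ! p \<in> E" if "p < card E" for p
    using that es by (metis nth_mem)
  have lt: "?es ! p < 2 * n" "\<phi> (?es ! p) < 2 * n" if "p < card E" for p
    using mem[OF that] E(1) \<phi>(2) by auto
  have mono: "?es ! p < ?es ! q" if "p < q" "q < card E" for p q
    using that es by (simp add: sorted_wrt_nth_less)
  have mono': "\<phi> (?es ! p) < \<phi> (?es ! q)" if "p < q" "q < card E" for p q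
    using mono[OF that] mem[of p] mem[of q] that \<phi>(1) by (auto simp: strict_mono_on_def)
  have e: "e \<in> increasing_maps (T + 2) (2 * n + T + 2)"
    using lt(1) mono by (fastforce simp: increasing_maps_def strict_mono_on_def e_def)
  have e': "e' \<in> increasing_maps (T + 2) (2 * n + T + 2)"
    using lt(2) mono' by (fastforce simp: increasing_maps_def strict_mono_on_def e'_def)
  have "g x < card E \<and> ?es ! g x = x" if "x \<in> E" for x
  proof -
    have "\<exists>p. p < card E \<and> ?es ! p = x"
      using that es by (metis in_set_conv_nth)
    then show ?thesis unfolding g_def by (rule someI_ex)
  qed
  then have "g x < T + 2 \<and> e (g x) = x \<and> e' (g x) = \<phi> x" if "x \<in> E" for x
    using that E(2) by (fastforce simp: e_def e'_def)
  with e e' show ?thesis by blast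
qed

lemma view_history:
  assumes g: "\<And>x. x \<in> E \<Longrightarrow> g x < T + 2 \<and> e (g x) = \<phi> x"
    and x: "x \<in> E" and L: "set L \<subseteq> insert None (Some ` E)"
  shows "view n T A (h \<circ> e) (r, g x, map (map_option g) L) =
    (shape n (history r (\<phi> x) (map (map_option \<phi>) L)),
     {q. q < T + 2 \<and> h (e q) \<in> labels (history r (\<phi> x) (map (map_option \<phi>) L))})"
proof -
  have L': "map (map_option (h \<circ> e)) (map (map_option g) L) = map (map_option h) (map (map_option \<phi>) L)"
    using g L by (force simp: option.map_comp intro!: option.map_cong)
  have x': "(h \<circ> e) (g x) = h (\<phi> x)"
    using g x by simp
  show ?thesis
    unfolding view_def history_def Let_def case_prod_conv L' x' by (simp only: comp_apply)
qed

lemma pattern_mem: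
  assumes g: "\<And>x. x \<in> E \<Longrightarrow> g x < T + 2"
    and "r \<in> seeds l" "x \<in> E" "set L \<subseteq> insert None (Some ` E)" "length L \<le> T"
  shows "(r, g x, map (map_option g) L) \<in> patterns l T"
proof -
  have "map_option g z \<in> insert None (Some ` {..<T + 2})" if "z \<in> set L" for z
    using that assms(4) g by (cases z) (force simp del: add_2_eq_Suc')+
  then show ?thesis
    using assms unfolding patterns_def by auto
qed

text \<open>The two histories realise the same pattern by different labels, so homogeneity equates
  their views.\<close>

lemma transfer:
  assumes E: "E \<subseteq> {..<2 * n}" "card E \<le> T + 2"
    and \<phi>: "strict_mono_on E \<phi>" "\<phi> ` E \<subseteq> {..<2 * n}"
    and L: "r \<in> seeds l" "x \<in> E" "set L \<subseteq> insert None (Some ` E)" "length L \<le> T"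
  shows "shape n (history r (\<phi> x) (map (map_option \<phi>) L)) = shape n (history r x L)"
    and "y \<in> E \<Longrightarrow> h (\<phi> y) \<in> labels (history r (\<phi> x) (map (map_option \<phi>) L)) \<longleftrightarrow> h y \<in> labels (history r x L)"
proof -
  obtain e e' g where e: "e \<in> increasing_maps (T + 2) (2 * n + T + 2)" "e' \<in> increasing_maps (T + 2) (2 * n + T + 2)"
    and g: "\<forall>x \<in> E. g x < T + 2 \<and> e (g x) = x \<and> e' (g x) = \<phi> x"
    using embed[OF E \<phi>] by (elim bexE exE)
  let ?a = "history r x L" and ?a' = "history r (\<phi> x) (map (map_option \<phi>) L)"
  have g1: "\<And>x. x \<in> E \<Longrightarrow> g x < T + 2" and g2: "\<And>x. x \<in> E \<Longrightarrow> g x < T + 2 \<and> e (g x) = id x"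
    and g3: "\<And>x. x \<in> E \<Longrightarrow> g x < T + 2 \<and> e' (g x) = \<phi> x"
    using g by simp_all
  have "view n T A (h \<circ> e') (r, g x, map (map_option g) L) = view n T A (h \<circ> e) (r, g x, map (map_option g) L)"
    by (rule hom[OF e(2,1) pattern_mem[of E g, OF g1 L]])
  moreover have "view n T A (h \<circ> e) (r, g x, map (map_option g) L) =
      (shape n ?a, {q. q < T + 2 \<and> h (e q) \<in> labels ?a})"
    using view_history[of E g e id x L r, OF g2 L(2,3)] by (simp only: option.map_id0 list.map_id0 id_apply)
  moreover have "view n T A (h \<circ> e') (r, g x, map (map_option g) L) =
      (shape n ?a', {q. q < T + 2 \<and> h (e' q) \<in> labels ?a'})"
    by (rule view_history[of E g e' \<phi> x L r, OF g3 L(2,3)])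
  ultimately have *: "shape n ?a' = shape n ?a"
    "{q. q < T + 2 \<and> h (e' q) \<in> labels ?a'} = {q. q < T + 2 \<and> h (e q) \<in> labels ?a}"
    by (simp_all only: prod.inject)
  show "shape n ?a' = shape n ?a" by (fact *)
  show "h (\<phi> y) \<in> labels ?a' \<longleftrightarrow> h y \<in> labels ?a" if "y \<in> E"
  proof -
    have "g y < T + 2" and ey: "e (g y) = y" "e' (g y) = \<phi> y"
      using g that by auto
    moreover have "g y < T + 2 \<and> h (e' (g y)) \<in> labels ?a' \<longleftrightarrow> g y < T + 2 \<and> h (e (g y)) \<in> labels ?a"
      using eqset_imp_iff[OF *(2), of "g y"] unfolding mem_Collect_eq .
    ultimately show ?thesis by (simp only: simp_thms)
  qed
qed

text \<open>Comparing the realisation of the ranks by \<open>E\<close> with the one by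
  \<open>id\<close> turns the history into one of those that define
  \<open>landmarks\<close>.\<close>

lemma landmarksI:
  assumes E: "E \<subseteq> {..<2 * n}" "card E \<le> T + 2"
    and L: "r \<in> seeds l" "x \<in> E" "set L \<subseteq> insert None (Some ` E)" "length L \<le> T"
    and i: "shape n (history r x L) = (1, i)" "1 \<le> i"
  shows "i \<in> landmarks"
proof -
  have id_mono: "strict_mono_on E id"
    by (simp add: strict_mono_on_def)
  have id_range: "id ` E \<subseteq> {..<2 * n}"
    using E(1) by simp
  obtain e e' g where e: "e \<in> increasing_maps (T + 2) (2 * n + T + 2)"
    and g: "\<forall>x \<in> E. g x < T + 2 \<and> e (g x) = x \<and> e' (g x) = id x"
    using embed[OF E id_mono id_range] by (elim bexE exE)
  have g1: "\<And>x. x \<in> E \<Longrightarrow> g x < T + 2" and g2: "\<And>x. x \<in> E \<Longrightarrow> g x < T + 2 \<and> e (g x) = id x"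
    and g3: "\<And>x. x \<in> E \<Longrightarrow> g x < T + 2 \<and> id (g x) = g x"
    using g by simp_all
  note pat = pattern_mem[of E g, OF g1 L]
  have "id \<in> increasing_maps (T + 2) (2 * n + T + 2)"
    by (auto simp: increasing_maps_def strict_mono_on_def)
  then have "view n T A (h \<circ> id) (r, g x, map (map_option g) L) = view n T A (h \<circ> e) (r, g x, map (map_option g) L)"
    by (rule hom[OF _ e pat])
  moreover have "fst (view n T A (h \<circ> e) (r, g x, map (map_option g) L)) = (1, i)"
    using view_history[of E g e id x L r, OF g2 L(2,3)] i by (simp only: option.map_id0 list.map_id0 id_apply fst_conv)
  moreover have "fst (view n T A (h \<circ> id) (r, g x, map (map_option g) L)) =
      shape n (history r (g x) (map (map_option g) L))"
    using view_history[of E g id g x L r, OF g3 L(2,3)] by (simp only: fst_conv)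
  ultimately have "shape n (history r (g x) (map (map_option g) L)) = (1, i)"
    by simp
  then show ?thesis
    using pat i(2) unfolding landmarks_def by blast
qed

text \<open>
  The labels with odd index stay out of the graph: they are the unused neighbors to which an unseen
  label is moved in \<open>vgap\<close>. Those from index \<open>2 * n\<close> on only serve to pad label sets to size \<open>T + 2\<close>.
\<close>

definition vertex :: "nat \<Rightarrow> nat" where
  "vertex q = h (2 * q)"

definition vhistory :: "bool list \<Rightarrow> nat \<Rightarrow> nat option list \<Rightarrow> query_alg" where
  "vhistory r x L = follow (A r (vertex x)) (map (map_option vertex) L)"

lemma h_inj: "inj_on h {..<2 * n + T + 2}"
  using h_mono by (rule strict_mono_on_imp_inj_on)

lemma vertex_inj: "inj_on vertex {..<n}"
proof (rule inj_onI)
  fix x y assume "x \<in> {..<n}" "y \<in> {..<n}" "vertex x = vertex y"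
  then have "2 * x = 2 * y" using inj_onD[OF h_inj, of "2 * x" "2 * y"] by (simp add: vertex_def)
  then show "x = y" by simp
qed

lemma gap_not_vertex: "y < n \<Longrightarrow> h (2 * y + 1) \<notin> vertex ` {..<n}"
proof
  assume "y < n" "h (2 * y + 1) \<in> vertex ` {..<n}"
  then obtain q where "q < n" "h (2 * y + 1) = h (2 * q)" by (auto simp: vertex_def)
  then have "2 * y + 1 = 2 * q" using h_inj \<open>y < n\<close> by (auto dest!: inj_onD)
  then show False by presburger
qed

lemma vhistory_eq: "vhistory r x L = history r (2 * x) (map (map_option ((*) 2)) L)"
proof -
  have "vertex = h \<circ> (*) 2" by (simp add: fun_eq_iff vertex_def)
  then show ?thesis by (simp add: vhistory_def history_def option.map_comp comp_def)
qed

context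
  fixes E r x L
  assumes E: "E \<subseteq> {..<n}" "card E \<le> T + 1"
    and L: "r \<in> seeds l" "x \<in> E" "set L \<subseteq> insert None (Some ` E)" "length L \<le> T"
begin

lemma double:
  shows "(*) 2 ` E \<subseteq> {..<2 * n}" "card ((*) 2 ` E) \<le> T + 1" "2 * x \<in> (*) 2 ` E"
    "set (map (map_option ((*) 2)) L) \<subseteq> insert None (Some ` (*) 2 ` E)"
  using E L card_image_le[OF finite_subset[OF E(1)], of "(*) 2"] by force+

lemma vtransfer:
  assumes \<phi>: "strict_mono_on E \<phi>" "\<phi> ` E \<subseteq> {..<n}"
  shows "shape n (vhistory r (\<phi> x) (map (map_option \<phi>) L)) = shape n (vhistory r x L)"
    and "y \<in> E \<Longrightarrow> vertex (\<phi> y) \<in> labels (vhistory r (\<phi> x) (map (map_option \<phi>) L)) \<longleftrightarrow>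
      vertex y \<in> labels (vhistory r x L)"
proof -
  define \<psi> where "\<psi> q = 2 * \<phi> (q div 2)" for q :: nat
  have m: "strict_mono_on ((*) 2 ` E) \<psi>" "\<psi> ` (*) 2 ` E \<subseteq> {..<2 * n}"
    using \<phi> by (auto simp: strict_mono_on_def \<psi>_def)
  have eq: "vhistory r (\<phi> x) (map (map_option \<phi>) L) =
      history r (\<psi> (2 * x)) (map (map_option \<psi>) (map (map_option ((*) 2)) L))"
    by (simp add: vhistory_eq \<psi>_def option.map_comp comp_def)
  note t = transfer[OF double(1) order.trans[OF double(2)] m L(1) double(3,4)]
  show "shape n (vhistory r (\<phi> x) (map (map_option \<phi>) L)) = shape n (vhistory r x L)"
    unfolding eq unfolding vhistory_eq by (rule t(1)) (use L in simp_all)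
  show "vertex (\<phi> y) \<in> labels (vhistory r (\<phi> x) (map (map_option \<phi>) L)) \<longleftrightarrow>
      vertex y \<in> labels (vhistory r x L)" if "y \<in> E"
    using t(2)[of "2 * y"] that L(4) unfolding eq unfolding vhistory_eq vertex_def by (simp add: \<psi>_def)
qed

text \<open>Moving the index \<open>2 * y\<close> to \<open>2 * y + 1\<close> keeps its order
  relative to all other even indices, and leaves the history alone because \<open>y\<close> does not
  occur in it. The set \<open>E\<close> together with \<open>y\<close> is what needs the size
  \<open>T + 2\<close>.\<close>

lemma vgap:
  assumes y: "y < n" "y \<notin> E" "vertex y \<in> labels (vhistory r x L)"
  shows "h (2 * y + 1) \<in> labels (vhistory r x L)"
proof -
  define \<psi> where "\<psi> q = (if q = 2 * y then 2 * y + 1 else q)" for q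
  let ?E = "insert (2 * y) ((*) 2 ` E)" and ?L = "map (map_option ((*) 2)) L"
  have E': "?E \<subseteq> {..<2 * n}" "card ?E \<le> T + 2"
    using double(1,2) y(1) card_insert_le_m1[of "T + 2" "(*) 2 ` E" "2 * y"] by auto
  have "strict_mono_on ?E \<psi>"
  proof (rule strict_mono_onI)
    fix a b assume "a \<in> ?E" "b \<in> ?E" "a < b"
    then show "\<psi> a < \<psi> b" using y(2) by (auto simp: \<psi>_def)
  qed
  moreover have "\<psi> ` ?E \<subseteq> {..<2 * n}"
    using E'(1) y(1) by (auto simp: \<psi>_def)
  moreover have "2 * x \<in> ?E" "set ?L \<subseteq> insert None (Some ` ?E)"
    using double(3,4) by blast+
  ultimately have *: "h (\<psi> (2 * y)) \<in> labels (history r (\<psi> (2 * x)) (map (map_option \<psi>) ?L)) \<longleftrightarrow>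
      h (2 * y) \<in> labels (history r (2 * x) ?L)"
    using transfer(2)[OF E' _ _ L(1), of \<psi> "2 * x" ?L "2 * y"] L(4) by simp
  have fixed: "\<psi> (2 * z) = 2 * z" if "z \<in> E" for z
    using that y(2) by (auto simp: \<psi>_def)
  have "map_option \<psi> (map_option ((*) 2) z) = map_option ((*) 2) z" if "z \<in> set L" for z
    using that L(3) fixed by (cases z) auto
  then have L': "map (map_option \<psi>) ?L = ?L"
    by simp
  have "\<psi> (2 * y) = 2 * y + 1"
    by (simp add: \<psi>_def)
  then show ?thesis
    using y(3) * unfolding vhistory_eq vertex_def fixed[OF L(2)] L' by (simp only:)
qed

lemma vlandmarksI:
  assumes "shape n (vhistory r x L) = (1, i)" "1 \<le> i"
  shows "i \<in> landmarks"
  using landmarksI[OF double(1) order.trans[OF double(2)] L(1) double(3,4)] L(4) assms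
  by (simp add: vhistory_eq)

end

end

section \<open>Executions related by an increasing map\<close>

lemma label_answer_clip:
  assumes "length (vlist G) = n" and "clip n i = clip n i'"
  shows "label_answer G i = label_answer G i'"
  using assms by (auto simp: label_answer_def clip_def split: if_splits)

lemma neighbor_answer_clip:
  assumes "v \<in> verts G \<Longrightarrow> length (nbrs G v) \<le> 2" and "clip 2 j = clip 2 j'"
  shows "neighbor_answer G v j = neighbor_answer G v j'"
  using assms by (auto simp: neighbor_answer_def clip_def split: if_splits)

context order_invariant
begin

lemma vhistory_snoc: "vhistory r x (L @ [z]) = follow (vhistory r x L) [map_option vertex z]"
  by (simp add: vhistory_def follow_snoc)

text \<open>
  Two executions in the same graph, started at \<open>x\<close> and at \<open>\<phi> x\<close>, stay \<open>\<phi>\<close>-related as long as \<open>\<phi>\<close> is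
  increasing on what can be seen; \<open>U t\<close> bounds what is seen after \<open>t\<close> queries.
\<close>

context
  fixes G :: lgraph and U :: "nat \<Rightarrow> nat set" and \<phi> :: "nat \<Rightarrow> nat" and r x
  assumes verts: "verts G \<subseteq> vertex ` {..<n}"
    and len: "length (vlist G) = n"
    and deg: "v \<in> verts G \<Longrightarrow> length (nbrs G v) \<le> 2"
    and U: "\<And>t. U t \<subseteq> U (Suc t)" "U T \<subseteq> {..<n}"
    and \<phi>: "strict_mono_on (U T) \<phi>" "\<phi> ` U T \<subseteq> {..<n}"
    and landmark: "i \<in> landmarks \<Longrightarrow> \<exists>g \<in> U 0. label_answer G i = Some (vertex g) \<and> \<phi> g = g"
    and neighbor: "\<lbrakk>t < T; u \<in> U t\<rbrakk> \<Longrightarrow> \<exists>z. set_option z \<subseteq> U (Suc t) \<and>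
      neighbor_answer G (vertex u) j = map_option vertex z \<and>
      neighbor_answer G (vertex (\<phi> u)) j = map_option (vertex \<circ> \<phi>) z"
    and r: "r \<in> seeds l" and x: "x \<in> U 0"
begin

lemma U_le: "s \<le> t \<Longrightarrow> U s \<subseteq> U t"
  using U(1) by (rule lift_Suc_mono_le)

text \<open>Induction on the tree of the first execution, with the other tree and the answer list
  arbitrary. The other execution needs no query bound of its own: its queries have the same
  shapes.\<close>

lemma simulation_aux:
  assumes "vhistory r x L = a" "vhistory r (\<phi> x) (map (map_option \<phi>) L) = a'"
    and "set L \<subseteq> insert None (Some ` U (length L))" "length L + num_queries G a \<le> T"
    and "run G a \<subseteq> verts G" "run G a' \<subseteq> verts G"
  shows "\<exists>D \<subseteq> U T. card D \<le> T + 1 \<and> run G a = vertex ` D \<and> run G a' = vertex ` \<phi> ` D"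
  using assms
proof (induction a arbitrary: a' L)
  \<comment> \<open>Homogeneity applies to at most \<open>T + 1\<close> labels, whereas
    \<open>U\<close> may be large. So \<open>E\<close> collects just the start and the answers
    received.\<close>
  have seen: "\<exists>E. E \<subseteq> U T \<and> x \<in> E \<and> card E \<le> T + 1 \<and> set L \<subseteq> insert None (Some ` E) \<and> E \<subseteq> U (length L)"
    if "set L \<subseteq> insert None (Some ` U (length L))" "length L \<le> T" for L
  proof (intro exI conjI)
    let ?E = "insert x (\<Union>z\<in>set L. set_option z)"
    show "?E \<subseteq> U (length L)"
      using that(1) x U_le[of 0 "length L"] by auto
    then show "?E \<subseteq> U T" using U_le[OF that(2)] by blast
    have card_option: "card (set_option z) \<le> 1" for z :: "nat option"
      by (cases z) auto
    have "card (\<Union>z\<in>set L. set_option z) \<le> (\<Sum>z\<in>set L. card (set_option z))"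
      by (rule card_UN_le) simp
    also have "\<dots> \<le> (\<Sum>z\<in>set L. 1)"
      by (rule sum_mono) (rule card_option)
    also have "\<dots> \<le> length L" by (simp add: card_length)
    finally show "card ?E \<le> T + 1"
      using that(2) card_insert_le_m1[of "T + 1" "\<Union>z\<in>set L. set_option z" x] by simp
    show "x \<in> ?E" by simp
    show "set L \<subseteq> insert None (Some ` ?E)"
    proof
      fix z assume z: "z \<in> set L"
      show "z \<in> insert None (Some ` ?E)"
      proof (cases z)
        case (Some g)
        then have "g \<in> ?E" using z by auto
        with Some show ?thesis by blast
      qed simp
    qed
  qed
  have \<phi>_on: "strict_mono_on E \<phi>" "\<phi> ` E \<subseteq> {..<n}" if "E \<subseteq> U T" for E
    using monotone_on_subset[OF \<phi>(1) that] image_mono[OF that, of \<phi>] \<phi>(2) by blast+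
  have map_over: "set (map (map_option \<phi>) L) \<subseteq> insert None (Some ` \<phi> ` E)"
    if "set L \<subseteq> insert None (Some ` E)" for L E
    using image_mono[OF that, of "map_option \<phi>"] by (simp add: image_image)
  \<comment> \<open>Mentioning an unseen vertex would mean mentioning the odd label next to it,
    which is no vertex. An output inside the vertex set cannot do so, nor can a neighbor query,
    which mentions a single label.\<close>
  have unseen: "y \<in> E"
    if E: "E \<subseteq> {..<n}" "card E \<le> T + 1" "x' \<in> E" "set L \<subseteq> insert None (Some ` E)" "length L \<le> T"
      and y: "y < n" "vertex y \<in> labels (vhistory r x' L)"
      and lab: "labels (vhistory r x' L) \<subseteq> insert (vertex y) (vertex ` {..<n})" for E x' L y
  proof (rule ccontr)
    assume "y \<notin> E"
    then have "h (2 * y + 1) \<in> labels (vhistory r x' L)"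
      using vgap[OF E(1,2) r E(3-5) y(1) _ y(2)] by blast
    then show False using lab gap_not_vertex[OF y(1)] y(1) by blast
  qed
  {
    case (Output B)
    obtain E where E: "E \<subseteq> U T" "x \<in> E" "card E \<le> T + 1" "set L \<subseteq> insert None (Some ` E)"
      using seen[of L] Output by auto
    have En: "E \<subseteq> {..<n}" and L: "length L \<le> T" using E(1) U(2) Output by auto
    note \<phi>E = \<phi>_on[OF E(1)]
    note t = vtransfer[OF En E(3) r E(2,4) L \<phi>E]
    obtain B' where B': "a' = Output B'"
      using t(1) Output.prems(1,2) by (cases a') auto
    have "B \<subseteq> vertex ` E"
    proof
      fix v assume "v \<in> B"
      then obtain y where "y < n" "v = vertex y" using Output.prems(5) verts by auto
      then show "v \<in> vertex ` E"
        using unseen[OF En E(3,2,4) L, of y] \<open>v \<in> B\<close> Output.prems(1,5) verts by auto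
    qed
    moreover have "B' \<subseteq> vertex ` \<phi> ` E"
    proof
      fix v assume "v \<in> B'"
      then obtain y where "y < n" "v = vertex y" using Output.prems(6) verts B' by auto
      moreover have "card (\<phi> ` E) \<le> T + 1"
        using E(3) card_image_le[OF finite_subset[OF En], of \<phi>] by simp
      moreover have "set (map (map_option \<phi>) L) \<subseteq> insert None (Some ` \<phi> ` E)"
        using map_over[OF E(4)] .
      ultimately show "v \<in> vertex ` \<phi> ` E"
        using unseen[OF \<phi>E(2), of "\<phi> x" "map (map_option \<phi>) L" y] E(2) L \<open>v \<in> B'\<close> Output.prems(2,6) verts B' by auto
    qed
    moreover have "vertex (\<phi> y) \<in> B' \<longleftrightarrow> vertex y \<in> B" if "y \<in> E" for y
      using t(2)[OF that] Output.prems(1,2) B' by simp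
    ultimately have "B = vertex ` {y \<in> E. vertex y \<in> B}" "B' = vertex ` \<phi> ` {y \<in> E. vertex y \<in> B}"
      by blast+
    moreover have "card {y \<in> E. vertex y \<in> B} \<le> T + 1"
      using E(3) card_mono[OF finite_subset[OF En], of "{y \<in> E. vertex y \<in> B}"] by auto
    ultimately show ?case
      using B' E(1) by (intro exI[of _ "{y \<in> E. vertex y \<in> B}"]) auto
  next
    case (Label_Query i k)
    obtain E where E: "E \<subseteq> U T" "x \<in> E" "card E \<le> T + 1" "set L \<subseteq> insert None (Some ` E)"
      using seen[of L] Label_Query.prems by auto
    have En: "E \<subseteq> {..<n}" and L: "length L \<le> T" using E(1) U(2) Label_Query.prems by auto
    note \<phi>E = \<phi>_on[OF E(1)]
    have "shape n a' = (1, clip n i)"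
      using vtransfer(1)[OF En E(3) r E(2,4) L \<phi>E] Label_Query.prems(1,2) by simp
    then obtain i' k' where a': "a' = Label_Query i' k'" and i': "clip n i' = clip n i"
      by (cases a') auto
    have ans': "label_answer G i' = label_answer G i"
      using label_answer_clip[OF len i'] .
    \<comment> \<open>A position in range is a landmark, whose vertex is fixed by
      \<open>\<phi>\<close>; any other position is answered by \<open>None\<close> in both
      executions.\<close>
    have "\<exists>z. label_answer G i = map_option vertex z \<and> set_option z \<subseteq> U 0 \<and> map_option \<phi> z = z"
    proof (cases "1 \<le> i \<and> i \<le> n")
      case True
      then have "i \<in> landmarks"
        using vlandmarksI[OF En E(3) r E(2,4) L, of i] Label_Query.prems(1) by (simp add: clip_def)
      then obtain g where "g \<in> U 0" "label_answer G i = Some (vertex g)" "\<phi> g = g"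
        using landmark by blast
      then show ?thesis by (intro exI[of _ "Some g"]) simp
    next
      case False
      then show ?thesis by (intro exI[of _ None]) (auto simp: label_answer_def len)
    qed
    then obtain z where z: "label_answer G i = map_option vertex z" "set_option z \<subseteq> U 0" "map_option \<phi> z = z"
      by blast
    have "\<exists>D \<subseteq> U T. card D \<le> T + 1 \<and> run G (k (label_answer G i)) = vertex ` D \<and>
        run G (k' (label_answer G i)) = vertex ` \<phi> ` D"
    proof (rule Label_Query.IH[OF rangeI, of "L @ [z]"])
      show "vhistory r x (L @ [z]) = k (label_answer G i)"
        using Label_Query.prems(1) z(1) by (simp add: vhistory_snoc)
      show "vhistory r (\<phi> x) (map (map_option \<phi>) (L @ [z])) = k' (label_answer G i)"
        using Label_Query.prems(2) a' z by (simp add: vhistory_snoc)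
      have "set_option z \<subseteq> U (length (L @ [z]))" "U (length L) \<subseteq> U (length (L @ [z]))"
        using z(2) U_le[of 0 "length (L @ [z])"] U(1)[of "length L"] by auto
      then show "set (L @ [z]) \<subseteq> insert None (Some ` U (length (L @ [z])))"
        using Label_Query.prems(3) by (cases z) auto
      show "length (L @ [z]) + num_queries G (k (label_answer G i)) \<le> T"
        using Label_Query.prems(4) by simp
      show "run G (k (label_answer G i)) \<subseteq> verts G" "run G (k' (label_answer G i)) \<subseteq> verts G"
        using Label_Query.prems(5,6) a' ans' by simp_all
    qed
    then show ?case using a' ans' by simp
  next
    case (Neighbor_Query v j k)
    obtain E where E: "E \<subseteq> U T" "x \<in> E" "card E \<le> T + 1" "set L \<subseteq> insert None (Some ` E)" "E \<subseteq> U (length L)"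
      using seen[of L] Neighbor_Query.prems by auto
    have En: "E \<subseteq> {..<n}" and L: "length L \<le> T" "length L < T" using E(1) U(2) Neighbor_Query.prems by auto
    note \<phi>E = \<phi>_on[OF E(1)]
    note t = vtransfer[OF En E(3) r E(2,4) L(1) \<phi>E]
    obtain v' j' k' where a': "a' = Neighbor_Query v' j' k'" and j': "clip 2 j' = clip 2 j"
      using t(1) Neighbor_Query.prems(1,2) by (cases a') auto
    have vv: "vertex (\<phi> y) = v' \<longleftrightarrow> vertex y = v" if "y \<in> E" for y
      using t(2)[OF that] Neighbor_Query.prems(1,2) a' by simp
    have "\<exists>z. set_option z \<subseteq> U (Suc (length L)) \<and> neighbor_answer G v j = map_option vertex z \<and>
        neighbor_answer G v' j' = map_option (vertex \<circ> \<phi>) z"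
    proof (cases "v \<in> vertex ` E")
      case True
      then obtain u where u: "u \<in> E" "v = vertex u" by blast
      then have v': "v' = vertex (\<phi> u)" using vv by metis
      have "neighbor_answer G v' j' = neighbor_answer G v' j"
        using neighbor_answer_clip[OF deg j'] .
      moreover have "u \<in> U (length L)" using u E(5) by blast
      ultimately show ?thesis
        using neighbor[OF L(2), of u j] u(2) v' by metis
    next
      case False
      \<comment> \<open>A query at an unseen label is answered by \<open>None\<close> on both sides,
        since by \<open>unseen\<close> neither label is a vertex.\<close>
      have "v \<notin> verts G"
      proof
        assume "v \<in> verts G"
        then obtain y where y: "y < n" "v = vertex y" using verts by auto
        then have "y \<in> E"
          using unseen[OF En E(3,2,4) L(1), of y] Neighbor_Query.prems(1) by auto
        then show False using False y by blast
      qed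
      moreover have "v' \<notin> verts G"
      proof
        assume "v' \<in> verts G"
        then obtain y where y: "y < n" "v' = vertex y" using verts by auto
        moreover have "card (\<phi> ` E) \<le> T + 1"
          using E(3) card_image_le[OF finite_subset[OF En], of \<phi>] by simp
        moreover have "set (map (map_option \<phi>) L) \<subseteq> insert None (Some ` \<phi> ` E)"
          using map_over[OF E(4)] .
        ultimately have "y \<in> \<phi> ` E"
          using unseen[OF \<phi>E(2), of "\<phi> x" "map (map_option \<phi>) L" y] E(2) L(1) Neighbor_Query.prems(2) a' by auto
        then show False using False y vv by blast
      qed
      ultimately show ?thesis by (intro exI[of _ None]) (simp add: neighbor_answer_def)
    qed
    then obtain z where z: "set_option z \<subseteq> U (Suc (length L))" "neighbor_answer G v j = map_option vertex z"
        "neighbor_answer G v' j' = map_option (vertex \<circ> \<phi>) z"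
      by blast
    have "\<exists>D \<subseteq> U T. card D \<le> T + 1 \<and> run G (k (neighbor_answer G v j)) = vertex ` D \<and>
        run G (k' (neighbor_answer G v' j')) = vertex ` \<phi> ` D"
    proof (rule Neighbor_Query.IH[OF rangeI, of "L @ [z]"])
      show "vhistory r x (L @ [z]) = k (neighbor_answer G v j)"
        using Neighbor_Query.prems(1) z(2) by (simp add: vhistory_snoc)
      show "vhistory r (\<phi> x) (map (map_option \<phi>) (L @ [z])) = k' (neighbor_answer G v' j')"
        using Neighbor_Query.prems(2) a' z(3) by (simp add: vhistory_snoc option.map_comp)
      show "set (L @ [z]) \<subseteq> insert None (Some ` U (length (L @ [z])))"
        using Neighbor_Query.prems(3) z(1) U(1)[of "length L"] by (cases z) auto
      show "length (L @ [z]) + num_queries G (k (neighbor_answer G v j)) \<le> T"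
        using Neighbor_Query.prems(4) by simp
      show "run G (k (neighbor_answer G v j)) \<subseteq> verts G" "run G (k' (neighbor_answer G v' j')) \<subseteq> verts G"
        using Neighbor_Query.prems(5,6) a' by simp_all
    qed
    then show ?case using a' by simp
  }
qed

lemma simulation:
  assumes "num_queries G (A r (vertex x)) \<le> T"
    and "run G (A r (vertex x)) \<subseteq> verts G" "run G (A r (vertex (\<phi> x))) \<subseteq> verts G"
  shows "\<exists>D \<subseteq> U T. card D \<le> T + 1 \<and> run G (A r (vertex x)) = vertex ` D \<and>
    run G (A r (vertex (\<phi> x))) = vertex ` \<phi> ` D"
  using assms by (intro simulation_aux[of "[]"]) (simp_all add: vhistory_def)

end

end

section \<open>Labelled cycles\<close>

text \<open>Every vertex lists its successor first and its predecessor second. This common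
  orientation makes neighbor queries commute with translation.\<close>

definition cycle_nbr :: "nat \<Rightarrow> nat \<Rightarrow> nat \<Rightarrow> nat option" where
  "cycle_nbr n k j = (if j = 1 then Some (if Suc k = n then 0 else Suc k)
     else if j = 2 then Some (if k = 0 then n - 1 else k - 1) else None)"

text \<open>The labels along the cycle are given by \<open>w\<close>, the order for label queries by
  \<open>\<sigma>\<close>; the two are chosen independently.\<close>

definition cycle_graph :: "nat \<Rightarrow> (nat \<Rightarrow> nat) \<Rightarrow> (nat \<Rightarrow> nat) \<Rightarrow> lgraph" where
  "cycle_graph n w \<sigma> = \<lparr>vlist = map (\<lambda>i. w (\<sigma> i)) [0..<n],
     nbrs = \<lambda>v. let k = inv_into {..<n} w v in
       [w (if Suc k = n then 0 else Suc k), w (if k = 0 then n - 1 else k - 1)]\<rparr>"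

locale labelled_cycle =
  fixes n :: nat and w \<sigma> :: "nat \<Rightarrow> nat" and G :: lgraph
  assumes n_ge: "3 \<le> n" and w_inj: "inj_on w {..<n}" and perm: "bij_betw \<sigma> {..<n} {..<n}"
  defines "G \<equiv> cycle_graph n w \<sigma>"
begin

lemma nbrs: "k < n \<Longrightarrow> nbrs G (w k) = [w (if Suc k = n then 0 else Suc k), w (if k = 0 then n - 1 else k - 1)]"
  using w_inj by (simp add: G_def cycle_graph_def Let_def)

lemma length_vlist: "length (vlist G) = n"
  by (simp add: G_def cycle_graph_def)

lemma verts: "verts G = w ` {..<n}"
proof -
  have "verts G = w ` \<sigma> ` {..<n}"
    by (simp add: verts_def G_def cycle_graph_def image_image atLeast0LessThan)
  then show ?thesis using perm by (simp add: bij_betw_def)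
qed

lemma card_verts: "card (verts G) = n"
  using w_inj by (simp add: verts card_image)

lemma w_eq_iff: "i < n \<Longrightarrow> k < n \<Longrightarrow> w i = w k \<longleftrightarrow> i = k"
  using w_inj by (auto dest: inj_onD)

lemma label_answer: "1 \<le> i \<Longrightarrow> i \<le> n \<Longrightarrow> label_answer G i = Some (w (\<sigma> (i - 1)))"
  by (cases i) (auto simp: label_answer_def G_def cycle_graph_def)

lemma neighbor_answer: "k < n \<Longrightarrow> neighbor_answer G (w k) j = map_option w (cycle_nbr n k j)"
  using n_ge by (auto simp: neighbor_answer_def verts nbrs cycle_nbr_def nth_Cons' numeral_2_eq_2)

lemma mod_succ: "i < n \<Longrightarrow> Suc i mod n = (if Suc i = n then 0 else Suc i)"
  by (simp add: mod_if)

lemma edges: "edges G = {{w i, w (Suc i mod n)} | i. i < n}"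
proof (intro equalityI subsetI)
  fix e assume "e \<in> edges G"
  then obtain k v where k: "k < n" "e = {w k, v}" "v \<in> set (nbrs G (w k))"
    by (auto simp: edges_def verts)
  consider "v = w (Suc k mod n)" | "k = 0" "v = w (n - 1)" | "k > 0" "v = w (k - 1)"
    using k(1,3) by (cases "k = 0") (auto simp: nbrs mod_succ)
  then show "e \<in> {{w i, w (Suc i mod n)} | i. i < n}"
  proof cases
    case 1
    then show ?thesis using k by blast
  next
    case 2
    then have "e = {w (n - 1), w (Suc (n - 1) mod n)}" using k n_ge by auto
    then show ?thesis using n_ge by (intro CollectI exI[of _ "n - 1"]) simp
  next
    case 3
    then have "e = {w (k - 1), w (Suc (k - 1) mod n)}" using k by auto
    then show ?thesis using k(1) less_imp_diff_less by blast
  qed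
next
  fix e assume "e \<in> {{w i, w (Suc i mod n)} | i. i < n}"
  then obtain i where "i < n" "e = {w i, w (Suc i mod n)}" by blast
  moreover from this have "w (Suc i mod n) \<in> set (nbrs G (w i))"
    by (simp add: nbrs mod_succ)
  ultimately show "e \<in> edges G"
    unfolding edges_def verts by blast
qed

lemma label_cycle:
  assumes "w ` {..<n} \<subseteq> {1..N}"
  shows "G \<in> label_cycles N n"
proof -
  have "distinct (vlist G)"
    using length_vlist card_verts by (simp add: verts_def card_distinct)
  moreover have "distinct (nbrs G v) \<and> length (nbrs G v) \<le> 2 \<and> set (nbrs G v) \<subseteq> verts G - {v} \<and>
      (\<forall>u\<in>set (nbrs G v). v \<in> set (nbrs G u))" if v: "v \<in> verts G" for v
  proof -
    obtain k where "k < n" "v = w k" using v unfolding verts by blast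
    then show ?thesis using n_ge by (auto simp: nbrs verts w_eq_iff)
  qed
  ultimately have "general_label_graph N n 2 G"
    using assms length_vlist verts by (simp add: general_label_graph_def)
  moreover have "bij_betw w {..<n} (verts G)"
    using w_inj verts by (simp add: bij_betw_def)
  then have "is_cycle G"
    unfolding is_cycle_def Let_def card_verts using n_ge edges by blast
  ultimately show ?thesis by (simp add: label_cycles_def)
qed

lemma edge_inj: "inj_on (\<lambda>i. {w i, w (Suc i mod n)}) {..<n}"
proof (rule inj_onI)
  fix i k assume ik: "i \<in> {..<n}" "k \<in> {..<n}" "{w i, w (Suc i mod n)} = {w k, w (Suc k mod n)}"
  then show "i = k"
    using n_ge by (auto simp: doubleton_eq_iff w_eq_iff mod_succ split: if_splits)
qed

text \<open>Each singleton part is charged with the edge to its successor.\<close>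

lemma singleton_parts_crossing:
  assumes P: "partition_on (verts G) P" and K: "K \<subseteq> {..<n}" "\<And>k. k \<in> K \<Longrightarrow> {w k} \<in> P"
  shows "card K \<le> card (crossing_edges G P)"
proof -
  have "{w k, w (Suc k mod n)} \<in> crossing_edges G P" if "k \<in> K" for k
  proof -
    have k: "k < n" using that K by auto
    have "False" if B: "B \<in> P" "{w k, w (Suc k mod n)} \<subseteq> B" for B
    proof -
      have "B = {w k}"
        using partition_onD2[OF P] K(2)[OF \<open>k \<in> K\<close>] B by (auto dest: disjointD)
      then have "w (Suc k mod n) = w k" using B by auto
      then show False using k n_ge by (auto simp: w_eq_iff mod_succ split: if_splits)
    qed
    then show ?thesis using k edges by (auto simp: crossing_edges_def)
  qed
  then have "(\<lambda>i. {w i, w (Suc i mod n)}) ` K \<subseteq> crossing_edges G P" by blast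
  moreover have "finite (crossing_edges G P)"
    by (rule finite_subset[of _ "edges G"]) (auto simp: crossing_edges_def edges)
  moreover have "inj_on (\<lambda>i. {w i, w (Suc i mod n)}) K"
    using edge_inj K(1) by (rule inj_on_subset)
  ultimately show ?thesis by (metis card_image card_mono)
qed

end

text \<open>Used with the landmarks as \<open>J\<close>: whatever label queries reveal then lies on
  the initial arc of length \<open>card J\<close>.\<close>

lemma ex_permutation_to_front:
  fixes J :: "nat set"
  assumes "J \<subseteq> {1..n}"
  shows "\<exists>\<sigma>. bij_betw \<sigma> {..<n} {..<n} \<and> (\<forall>i\<in>J. \<sigma> (i - 1) < card J)"
proof -
  let ?J = "(\<lambda>i. i - 1) ` J"
  have J: "?J \<subseteq> {..<n}" using assms by fastforce
  have "inj_on (\<lambda>i. i - 1) J"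
    using assms by (intro inj_onI) (metis Suc_pred' atLeastAtMost_iff less_eq_Suc_le One_nat_def subsetD)
  then have card: "card ?J = card J" by (rule card_image)
  then have le: "card J \<le> n" using card_mono[OF _ J] by simp
  obtain f where f: "bij_betw f ?J {..<card J}"
    using finite_same_card_bij[of ?J "{..<card J}"] finite_subset[OF J] card by auto
  obtain g where g: "bij_betw g ({..<n} - ?J) {card J..<n}"
    using finite_same_card_bij[of "{..<n} - ?J" "{card J..<n}"] card_Diff_subset[OF finite_subset[OF J] J] card by auto
  let ?\<sigma> = "\<lambda>i. if i \<in> ?J then f i else g i"
  have "bij_betw ?\<sigma> (?J \<union> ({..<n} - ?J)) ({..<card J} \<union> {card J..<n})"
    using f g by (rule bij_betw_disjoint_Un) auto
  moreover have "?J \<union> ({..<n} - ?J) = {..<n}" "{..<card J} \<union> {card J..<n} = {..<n}"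
    using J le by auto
  moreover have "?\<sigma> (i - 1) < card J" if "i \<in> J" for i
    using that f by (auto simp: bij_betw_def)
  ultimately show ?thesis by (metis (no_types, lifting))
qed

section \<open>Crossing edges\<close>

text \<open>The index \<open>m + 2 * T\<close> is the first whose \<open>T\<close>-neighborhood
  avoids the \<open>T\<close>-neighborhood of the arc. From there on, an output splits into a part
  that stays and a part that moves along. If something moves, the output differs from its
  translates, hence is disjoint from them, and this leaves room for one moving point only.\<close>

lemma translation_rigid:
  fixes I :: "nat \<Rightarrow> nat set"
  defines "s \<equiv> \<lambda>m T n k. if m + T \<le> k \<and> k < n - T then Suc k else k :: nat"
  assumes step: "\<And>i. \<lbrakk>m + 2 * T \<le> i; i + 2 * T + 1 < n\<rbrakk> \<Longrightarrow> I (Suc i) = s m T n ` I i"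
    and start: "I (m + 2 * T) \<subseteq> {k. k < n \<and> (k < m + T \<or> n \<le> k + T \<or> k \<le> m + 3 * T)}"
    and ne: "I (m + 2 * T) \<noteq> {}"
    and disj: "\<And>i k. i < n \<Longrightarrow> k < n \<Longrightarrow> I i = I k \<or> I i \<inter> I k = {}"
    and n: "m + 6 * T + 1 < n"
  shows "(\<forall>t \<le> n - 4 * T - m - 1. I (m + 2 * T + t) = I (m + 2 * T)) \<or>
    (\<exists>d. \<forall>t \<le> n - 4 * T - m - 1. d + t < n \<and> I (m + 2 * T + t) = {d + t})"
proof -
  define a R where "a = m + 2 * T" and "R = n - 4 * T - m - 1"
  have R: "a + R = n - 2 * T - 1" "2 * T \<le> R" "1 \<le> R" using n by (auto simp: a_def R_def)
  \<comment> \<open>The moving part. It has width at most \<open>2 * T\<close>, and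
    \<open>2 * T \<le> R\<close>, so any two of its points differ by an admissible number of
    steps.\<close>
  define W where "W = {k \<in> I a. m + T \<le> k \<and> k < n - T}"
  define Q where "Q = I a - W"
  have W: "m + T \<le> k" "k \<le> m + 3 * T" if "k \<in> W" for k
    using that start by (auto simp: W_def a_def)
  have finW: "finite W" using W(2) by (meson bounded_nat_set_is_finite le_imp_less_Suc)
  have shift: "I (a + t) = Q \<union> (\<lambda>k. k + t) ` W" if "t \<le> R" for t
    using that
  proof (induction t)
    case 0
    then show ?case by (auto simp: Q_def W_def)
  next
    case (Suc t)
    have "I (Suc (a + t)) = s m T n ` (Q \<union> (\<lambda>k. k + t) ` W)"
      using step[of "a + t"] Suc R by (simp add: a_def)
    also have "\<dots> = s m T n ` Q \<union> (\<lambda>k. s m T n (k + t)) ` W"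
      by (simp add: image_Un image_image)
    also have "s m T n ` Q = (\<lambda>k. k) ` Q"
      by (rule image_cong) (auto simp: s_def Q_def W_def)
    also have "(\<lambda>k. s m T n (k + t)) ` W = (\<lambda>k. k + Suc t) ` W"
    proof (rule image_cong)
      fix k assume "k \<in> W"
      then have "m + T \<le> k + t" "k + t < n - T" using W Suc.prems n by (fastforce simp: R_def)+
      then show "s m T n (k + t) = k + Suc t" by (simp add: s_def)
    qed simp
    finally show ?case by simp
  qed
  show ?thesis
  proof (cases "W = {}")
    case True
    then have "I (a + t) = I a" if "t \<le> R" for t
      using shift[OF that] shift[of 0] by simp
    then show ?thesis by (simp add: a_def R_def)
  next
    case False
    \<comment> \<open>If a translate coincided with \<open>I a\<close>, the largest moving point
      would be moved to a larger one.\<close>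
    have apart: "I (a + t) \<inter> I a = {}" if t: "1 \<le> t" "t \<le> R" for t
    proof (rule ccontr)
      assume "I (a + t) \<inter> I a \<noteq> {}"
      then have "I (a + t) = I a" using disj[of "a + t" a] R n t by auto
      moreover have "Max W \<in> W" using finW False by simp
      ultimately have "Max W + t \<in> I a" using shift[OF t(2)] by blast
      moreover have "m + T \<le> Max W + t" "Max W + t < n - T"
        using W[OF \<open>Max W \<in> W\<close>] t n by (auto simp: R_def)
      ultimately have "Max W + t \<in> W" by (simp add: W_def)
      then show False using Max_ge[OF finW] t by fastforce
    qed
    \<comment> \<open>Points that stay would lie in two disjoint sets.\<close>
    have "Q = {}"
      using shift[of 1] shift[of 0] apart[of 1] R by auto
    \<comment> \<open>Translating by \<open>e - d\<close> would carry \<open>d\<close> onto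
      \<open>e\<close>, so a translate would meet \<open>I a\<close>.\<close>
    have less_False: "\<not> d < e" if de: "d \<in> W" "e \<in> W" for d e
    proof
      assume "d < e"
      moreover have "e - d \<le> R" using W[OF de(1)] W[OF de(2)] R(2) by linarith
      moreover have "e \<in> (\<lambda>k. k + (e - d)) ` W" using de(1) \<open>d < e\<close> by (intro image_eqI[of _ _ d]) auto
      then have "e \<in> I (a + (e - d)) \<inter> I a" using shift[of "e - d"] shift[of 0] de \<open>e - d \<le> R\<close> by auto
      ultimately show False using apart[of "e - d"] by (auto simp: Suc_le_eq)
    qed
    obtain d where d: "d \<in> W" using False by blast
    have "e = d" if "e \<in> W" for e
      using less_False[OF d that] less_False[OF that d] by simp
    then have "W = {d}" using d by blast
    then have "I (a + t) = {d + t}" if "t \<le> R" for t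
      using shift[OF that] \<open>Q = {}\<close> by simp
    moreover have "d + t < n" if "t \<le> R" for t
      using W(2)[OF d] that n by (simp add: R_def)
    ultimately show ?thesis unfolding a_def R_def by blast
  qed
qed

section \<open>Crossing edges of the defeating cycle\<close>

context order_invariant
begin

lemma many_crossing_edges:
  assumes n3: "3 \<le> n" and big: "(T + 1) * (card landmarks + 4 * T + 1) < n" "card landmarks + 6 * T + 1 < n"
    and \<sigma>: "bij_betw \<sigma> {..<n} {..<n}" "\<And>i. i \<in> landmarks \<Longrightarrow> \<sigma> (i - 1) < card landmarks"
    and r: "r \<in> seeds l"
  defines "G \<equiv> cycle_graph n vertex \<sigma>"
  assumes P: "partition_on (verts G) (oracle_parts A G r)"
    and queries: "\<And>v. v \<in> verts G \<Longrightarrow> num_queries G (A r v) \<le> T"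
  shows "n - 4 * T - card landmarks \<le> card (crossing_edges G (oracle_parts A G r))"
proof -
  interpret labelled_cycle n vertex \<sigma> G
      rewrites "cycle_graph n vertex \<sigma> \<equiv> G"
    using n3 vertex_inj \<sigma>(1) unfolding G_def by unfold_locales auto
  define m where "m = card landmarks"
  define part where "part k = run G (A r (vertex k))" for k
  have parts: "oracle_parts A G r = part ` {..<n}"
    by (auto simp: oracle_parts_def part_def verts)
  have part_sub: "part k \<subseteq> verts G" if "k < n" for k
    using partition_onD1[OF P] that by (auto simp: parts)
  define I where "I k = {q. q < n \<and> vertex q \<in> part k}" for k
  have part_I: "part k = vertex ` I k" if "k < n" for k
    using part_sub[OF that] by (auto simp: I_def verts)
  have I_eq: "I k = D" if "part k = vertex ` D" "D \<subseteq> {..<n}" for k D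
    using that w_eq_iff by (auto simp: I_def)
  have vertex_in: "vertex k \<in> verts G" if "k < n" for k
    using that by (simp add: verts)
  have lm: "label_answer G i = Some (vertex (\<sigma> (i - 1)))" "\<sigma> (i - 1) < m" if "i \<in> landmarks" for i
    using that landmarks_range label_answer \<sigma>(2) by (auto simp: m_def)
  have deg: "length (nbrs G v) \<le> 2" if "v \<in> verts G" for v
    using that by (auto simp: verts nbrs)
  have card_part: "card (part k) \<le> T + 1" if k: "k < n" for k
  proof -
    \<comment> \<open>The simulation with \<open>id\<close> and no restriction on what is seen
      concerns a single execution; it is used for the bound on the size of a part.\<close>
    have "\<exists>D \<subseteq> {..<n}. card D \<le> T + 1 \<and> run G (A r (vertex k)) = vertex ` D \<and>
        run G (A r (vertex (id k))) = vertex ` id ` D"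
    proof (rule simulation[where U = "\<lambda>_. {..<n}"])
      show "verts G \<subseteq> vertex ` {..<n}" by (simp add: verts)
      show "\<exists>g\<in>{..<n}. label_answer G i = Some (vertex g) \<and> id g = g" if "i \<in> landmarks" for i
        using lm[OF that] big by (intro bexI[of _ "\<sigma> (i - 1)"]) (auto simp: m_def)
      show "\<exists>z. set_option z \<subseteq> {..<n} \<and> neighbor_answer G (vertex u) j = map_option vertex z \<and>
          neighbor_answer G (vertex (id u)) j = map_option (vertex \<circ> id) z" if "u \<in> {..<n}" for u j
        using that n3 by (intro exI[of _ "cycle_nbr n u j"]) (auto simp: neighbor_answer cycle_nbr_def split: if_splits)
    qed (use k r part_sub[OF k] length_vlist deg queries[OF vertex_in[OF k]] in \<open>auto simp: part_def strict_mono_on_def\<close>)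
    then obtain D where "D \<subseteq> {..<n}" "card D \<le> T + 1" "part k = vertex ` D"
      unfolding part_def by blast
    then show ?thesis
      using card_image_le[OF finite_subset[of D "{..<n}"], of vertex] by auto
  qed
  \<comment> \<open>The map \<open>s\<close> translates around \<open>i\<close> and fixes the arc
    with its surroundings. The set \<open>U i t\<close> consists of the vertices within distance
    \<open>t\<close> of the arc, cyclically, or of \<open>i\<close>; the bounds on \<open>i\<close>
    keep the two regions apart even after the translation.\<close>
  define s where "s k = (if m + T \<le> k \<and> k < n - T then Suc k else k)" for k
  define U where "U i t = {k. k < n \<and> (k < m + t \<or> n \<le> k + t \<or> (i \<le> k + t \<and> k \<le> i + t))}" for i t :: nat
  have shift: "I i \<subseteq> U i T \<and> I (Suc i) = s ` I i" if i: "m + 2 * T \<le> i" "i + 2 * T + 1 < n" for i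
  proof -
    have si: "s i = Suc i" using i by (auto simp: s_def)
    have "\<exists>D \<subseteq> U i T. card D \<le> T + 1 \<and> run G (A r (vertex i)) = vertex ` D \<and>
        run G (A r (vertex (s i))) = vertex ` s ` D"
    proof (rule simulation[where U = "U i"])
      show "verts G \<subseteq> vertex ` {..<n}" by (simp add: verts)
      show "U i t \<subseteq> U i (Suc t)" for t by (auto simp: U_def)
      show "U i T \<subseteq> {..<n}" by (auto simp: U_def)
      show "strict_mono_on (U i T) s"
        using i by (intro strict_mono_onI) (auto simp: U_def s_def)
      show "s ` U i T \<subseteq> {..<n}" using i by (auto simp: U_def s_def)
      show "\<exists>g\<in>U i 0. label_answer G j = Some (vertex g) \<and> s g = g" if "j \<in> landmarks" for j
        using lm[OF that] i by (intro bexI[of _ "\<sigma> (j - 1)"]) (auto simp: U_def s_def)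
      show "\<exists>z. set_option z \<subseteq> U i (Suc t) \<and> neighbor_answer G (vertex u) j = map_option vertex z \<and>
          neighbor_answer G (vertex (s u)) j = map_option (vertex \<circ> s) z" if tu: "t < T" "u \<in> U i t" for t u j
      proof (intro exI conjI)
        have u: "u < n" "s u < n" using tu by (auto simp: U_def s_def)
        show "set_option (cycle_nbr n u j) \<subseteq> U i (Suc t)"
          using tu i by (auto simp: U_def cycle_nbr_def split: if_splits)
        show "neighbor_answer G (vertex u) j = map_option vertex (cycle_nbr n u j)"
          using u by (simp add: neighbor_answer)
        have "cycle_nbr n (s u) j = map_option s (cycle_nbr n u j)"
          using tu i by (auto simp: U_def cycle_nbr_def s_def)
        then show "neighbor_answer G (vertex (s u)) j = map_option (vertex \<circ> s) (cycle_nbr n u j)"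
          using u by (simp add: neighbor_answer option.map_comp)
      qed
      show "i \<in> U i 0" using i by (simp add: U_def)
      show "run G (A r (vertex i)) \<subseteq> verts G" "run G (A r (vertex (s i))) \<subseteq> verts G"
        using part_sub i si by (simp_all add: part_def)
      show "num_queries G (A r (vertex i)) \<le> T"
        using i by (intro queries vertex_in) simp
    qed (use r length_vlist deg in auto)
    then obtain D where D: "D \<subseteq> U i T" "part i = vertex ` D" "part (Suc i) = vertex ` s ` D"
      unfolding part_def si by blast
    have sub: "U i T \<subseteq> {..<n}" "s ` U i T \<subseteq> {..<n}"
      using i by (auto simp: U_def s_def)
    have "I i = D"
      by (rule I_eq[OF D(2)]) (use D(1) sub(1) in blast)
    moreover have "I (Suc i) = s ` D"
      by (rule I_eq[OF D(3)]) (use D(1) sub(2) in blast)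
    ultimately show ?thesis using D(1) by simp
  qed
  have rigid: "(\<forall>t \<le> n - 4 * T - m - 1. I (m + 2 * T + t) = I (m + 2 * T)) \<or>
      (\<exists>d. \<forall>t \<le> n - 4 * T - m - 1. d + t < n \<and> I (m + 2 * T + t) = {d + t})"
  proof (rule translation_rigid)
    show "I (Suc i) = (\<lambda>k. if m + T \<le> k \<and> k < n - T then Suc k else k) ` I i"
      if "m + 2 * T \<le> i" "i + 2 * T + 1 < n" for i
      using shift[OF that] unfolding s_def by blast
    have "I (m + 2 * T) \<subseteq> U (m + 2 * T) T" using shift[of "m + 2 * T"] big(2) by (simp add: m_def)
    then show "I (m + 2 * T) \<subseteq> {k. k < n \<and> (k < m + T \<or> n \<le> k + T \<or> k \<le> m + 3 * T)}"
      by (auto simp: U_def)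
    have "m + 2 * T < n" using big(2) by (simp add: m_def)
    then have "part (m + 2 * T) \<noteq> {}"
      using partition_onD3[OF P] by (metis parts image_eqI lessThan_iff)
    then show "I (m + 2 * T) \<noteq> {}" using part_I[OF \<open>m + 2 * T < n\<close>] by auto
    show "I i = I k \<or> I i \<inter> I k = {}" if "i < n" "k < n" for i k
    proof -
      have "part i = part k \<or> part i \<inter> part k = {}"
        using partition_onD2[OF P] that unfolding parts by (meson disjointD imageI lessThan_iff)
      then show ?thesis unfolding I_def by auto
    qed
    show "m + 6 * T + 1 < n" using big(2) by (simp add: m_def)
  qed
  have sz: "m + 2 * T + (n - 4 * T - m - 1) = n - 2 * T - 1" "m + 6 * T + 1 < n"
    using big(2) by (auto simp: m_def)
  from rigid show ?thesis
  proof
    assume const: "\<forall>t \<le> n - 4 * T - m - 1. I (m + 2 * T + t) = I (m + 2 * T)"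
    \<comment> \<open>The vertices outside the range of the translation argument. They and the
      common output give at most \<open>m + 4 * T + 1\<close> parts of size at most
      \<open>T + 1\<close>, too few for \<open>n\<close> vertices.\<close>
    let ?K = "{..<m + 2 * T} \<union> {n - 2 * T..<n}"
    have "part k \<in> insert (part (m + 2 * T)) (part ` ?K)" if "k < n" for k
    proof (cases "k \<in> ?K")
      case False
      then have "I k = I (m + 2 * T)" using const[rule_format, of "k - (m + 2 * T)"] that by auto
      then show ?thesis using part_I[OF that] part_I[of "m + 2 * T"] sz by simp
    qed simp
    then have sub: "oracle_parts A G r \<subseteq> insert (part (m + 2 * T)) (part ` ?K)" by (auto simp: parts)
    have "card (oracle_parts A G r) \<le> card (insert (part (m + 2 * T)) (part ` ?K))"
      by (rule card_mono[OF _ sub]) simp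
    also have "\<dots> \<le> Suc (card (part ` ?K))" by (rule card_insert_le_m1) simp_all
    also have "card (part ` ?K) \<le> card ?K" by (rule card_image_le) simp
    also have "card ?K \<le> (m + 2 * T) + 2 * T"
      by (rule order.trans[OF card_Un_le]) simp
    finally have few: "card (oracle_parts A G r) \<le> m + 4 * T + 1" by simp
    have "n = card (\<Union>(oracle_parts A G r))"
      using partition_onD1[OF P] card_verts by simp
    also have "\<dots> \<le> (\<Sum>B\<in>oracle_parts A G r. card B)"
      by (rule card_Union_le_sum_card)
    also have "\<dots> \<le> (\<Sum>B\<in>oracle_parts A G r. T + 1)"
      using card_part by (intro sum_mono) (auto simp: parts)
    also have "\<dots> = card (oracle_parts A G r) * (T + 1)"
      by simp
    also have "\<dots> \<le> (m + 4 * T + 1) * (T + 1)"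
      using few by (rule mult_le_mono1)
    finally show ?thesis using big(1) by (simp add: m_def mult.commute)
  next
    assume "\<exists>d. \<forall>t \<le> n - 4 * T - m - 1. d + t < n \<and> I (m + 2 * T + t) = {d + t}"
    then obtain d where d: "\<And>t. t \<le> n - 4 * T - m - 1 \<Longrightarrow> d + t < n \<and> I (m + 2 * T + t) = {d + t}"
      by blast
    have "card ((\<lambda>t. d + t) ` {..n - 4 * T - m - 1}) \<le> card (crossing_edges G (oracle_parts A G r))"
    proof (rule singleton_parts_crossing[OF P])
      show "(\<lambda>t. d + t) ` {..n - 4 * T - m - 1} \<subseteq> {..<n}" using d by auto
      fix k assume "k \<in> (\<lambda>t. d + t) ` {..n - 4 * T - m - 1}"
      then obtain t where t: "t \<le> n - 4 * T - m - 1" "k = d + t" by auto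
      then have "m + 2 * T + t < n" using sz by linarith
      then show "{vertex k} \<in> oracle_parts A G r"
        using part_I[of "m + 2 * T + t"] d[OF t(1)] t(2) by (auto simp: parts intro!: image_eqI)
    qed
    then show ?thesis using sz by (simp add: card_image m_def)
  qed
qed

end

section \<open>Choice of parameters and growth rates\<close>

lemma no_partition_oracle:
  fixes T l :: nat
  shows "\<exists>n\<^sub>0. \<forall>n\<ge>n\<^sub>0. \<exists>N\<^sub>0. \<forall>N\<ge>N\<^sub>0. \<forall>\<epsilon> A. \<epsilon> < 1/4 \<longrightarrow> \<not> partition_oracle (label_cycles N n) 2 \<epsilon> T l A"
proof -
  define M where "M = card (patterns l T)"
  \<comment> \<open>This \<open>n\<close> exceeds what the two cases need, and the factor
    \<open>2\<close> makes the vertices lost near the arc at most half of the cycle.\<close>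
  show ?thesis
  proof (rule exI[of _ "2 * (T + 1) * (M + 4 * T + 1) + 6 * T + 3"], intro allI impI)
    fix n assume n: "2 * (T + 1) * (M + 4 * T + 1) + 6 * T + 3 \<le> n"
    obtain N\<^sub>0 where N0: "\<And>N A. N \<ge> N\<^sub>0 \<Longrightarrow> \<exists>h. h ` {..<2 * n + T + 2} \<subseteq> {1..N} \<and> order_invariant n T l A h"
      using ex_order_invariant by metis
    have "\<not> partition_oracle (label_cycles N n) 2 \<epsilon> T l A" if N: "N \<ge> N\<^sub>0" and \<epsilon>: "\<epsilon> < 1/4" for N \<epsilon> A
    proof
      assume po: "partition_oracle (label_cycles N n) 2 \<epsilon> T l A"
      obtain h where h: "h ` {..<2 * n + T + 2} \<subseteq> {1..N}" "order_invariant n T l A h"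
        using N0[OF N] by blast
      interpret order_invariant n T l A h by (fact h(2))
      have m: "card landmarks \<le> M" using card_landmarks(2) by (simp add: M_def)
      obtain \<sigma> where \<sigma>: "bij_betw \<sigma> {..<n} {..<n}" "\<And>i. i \<in> landmarks \<Longrightarrow> \<sigma> (i - 1) < card landmarks"
        using ex_permutation_to_front[OF landmarks_range] by blast
      define G where G: "G = cycle_graph n vertex \<sigma>"
      interpret labelled_cycle n vertex \<sigma> G
          rewrites "cycle_graph n vertex \<sigma> \<equiv> G"
        using n vertex_inj \<sigma>(1) unfolding G by unfold_locales auto
      have "vertex ` {..<n} \<subseteq> {1..N}"
        using h(1) by (auto simp: vertex_def image_subset_iff)
      then have G_cycle: "G \<in> label_cycles N n" by (rule label_cycle)
      have prob: "measure_pmf.prob (pmf_of_set (seeds l))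
          {r. real (card (crossing_edges G (oracle_parts A G r))) \<le> \<epsilon> * real 2 * real (card (verts G))} \<ge> 2 / 3"
        using po G_cycle unfolding partition_oracle_def by blast
      \<comment> \<open>Positive probability gives a good seed; the cycle was built to be bad for
        every seed.\<close>
      have "\<exists>r \<in> seeds l. real (card (crossing_edges G (oracle_parts A G r))) \<le> \<epsilon> * real 2 * real (card (verts G))"
      proof (rule ccontr)
        assume "\<not> ?thesis"
        then have "seeds l \<inter> {r. real (card (crossing_edges G (oracle_parts A G r))) \<le> \<epsilon> * real 2 * real (card (verts G))} = {}"
          by blast
        then show False
          using prob measure_pmf_of_set[OF seeds_nonempty finite_seeds] by simp
      qed
      then obtain r where r: "r \<in> seeds l" "real (card (crossing_edges G (oracle_parts A G r))) \<le> 2 * \<epsilon> * real n"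
        using card_verts by (auto simp: mult_ac)
      define X where "X = (T + 1) * (M + 4 * T + 1)"
      have "(T + 1) * (card landmarks + 4 * T + 1) \<le> X"
        unfolding X_def using m by (intro mult_le_mono) auto
      moreover have X: "M + 4 * T + 1 \<le> X" by (simp add: X_def)
      moreover have nX: "2 * X + 6 * T + 3 \<le> n" using n by (simp only: X_def mult.assoc)
      ultimately have big: "(T + 1) * (card landmarks + 4 * T + 1) < n" "card landmarks + 6 * T + 1 < n"
        using m by linarith+
      have half: "2 * (card landmarks + 4 * T) \<le> n"
        using X nX m by presburger
      have "n - 4 * T - card landmarks \<le> card (crossing_edges G (oracle_parts A G r))"
        unfolding G
      proof (rule many_crossing_edges[where \<sigma> = \<sigma> and r = r])
        show "3 \<le> n" using n by simp
        show "(T + 1) * (card landmarks + 4 * T + 1) < n" "card landmarks + 6 * T + 1 < n"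
          by (fact big)+
        show "bij_betw \<sigma> {..<n} {..<n}" "\<And>i. i \<in> landmarks \<Longrightarrow> \<sigma> (i - 1) < card landmarks"
          by (fact \<sigma>)+
        show "r \<in> seeds l" by (fact r)
        show "partition_on (verts (cycle_graph n vertex \<sigma>)) (oracle_parts A (cycle_graph n vertex \<sigma>) r)"
          "v \<in> verts (cycle_graph n vertex \<sigma>) \<Longrightarrow> num_queries (cycle_graph n vertex \<sigma>) (A r v) \<le> T" for v
          using po G_cycle r(1) unfolding partition_oracle_def G by blast+
      qed
      then have "n \<le> 2 * card (crossing_edges G (oracle_parts A G r))"
        using half by presburger
      then have "real n / 2 \<le> real (card (crossing_edges G (oracle_parts A G r)))"
        by simp
      \<comment> \<open>With \<open>d = 2\<close> the budget is \<open>2 * \<epsilon> * n\<close>,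
        below the \<open>n / 2\<close> crossing edges exactly when
        \<open>\<epsilon> < 1/4\<close>.\<close>
      moreover have "2 * \<epsilon> * real n < 2 * (1/4) * real n"
        using \<epsilon> n by (intro mult_strict_right_mono) auto
      ultimately show False using r(2) by linarith
    qed
    then show "\<exists>N\<^sub>0. \<forall>N\<ge>N\<^sub>0. \<forall>\<epsilon> A. \<epsilon> < 1/4 \<longrightarrow> \<not> partition_oracle (label_cycles N n) 2 \<epsilon> T l A"
      by blast
  qed
qed

text \<open>An inverse of \<open>m ^ 2 + (\<Sum>n\<le>m. g n)\<close>: the square forces growth at
  most \<open>sqrt N\<close>, the sum dominates every \<open>g n\<close> with
  \<open>n \<le> m\<close>.\<close>

lemma ex_slow_inverse:
  fixes g :: "nat \<Rightarrow> nat"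
  shows "\<exists>h :: nat \<Rightarrow> nat. filterlim h at_top at_top \<and> (\<lambda>N. real (h N)) \<in> o(\<lambda>N. real N) \<and>
    (\<forall>N n. 0 < n \<longrightarrow> n \<le> h N \<longrightarrow> g n \<le> N)"
proof -
  define G where "G m = m ^ 2 + (\<Sum>n\<le>m. g n)" for m
  \<comment> \<open>The inserted \<open>0\<close> covers \<open>N\<close> below all values of
    \<open>G\<close>; hence the restriction to \<open>0 < n\<close>.\<close>
  define h where "h N = Max (insert 0 {m. G m \<le> N})" for N
  have square: "m ^ 2 \<le> G m" for m by (simp add: G_def)
  have fin: "finite {m. G m \<le> N}" for N
  proof (rule finite_subset)
    show "{m. G m \<le> N} \<subseteq> {..N}"
    proof
      fix m assume "m \<in> {m. G m \<le> N}"
      then have "m * m \<le> N" using square[of m] by (simp add: power2_eq_square)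
      then show "m \<in> {..N}" by (metis atMost_iff le_square order.trans)
    qed
  qed simp
  have h_mem: "h N = 0 \<or> G (h N) \<le> N" for N
    using Max_in[of "insert 0 {m. G m \<le> N}"] fin[of N] unfolding h_def by blast
  have h_ge: "m \<le> h N" if "G m \<le> N" for m N
    unfolding h_def using fin[of N] that by (intro Max_ge) auto
  have "filterlim h at_top at_top"
    unfolding filterlim_at_top
  proof
    fix m
    show "\<forall>\<^sub>F N in at_top. m \<le> h N"
      using eventually_ge_at_top[of "G m"] by eventually_elim (rule h_ge)
  qed
  moreover have "(\<lambda>N. real (h N)) \<in> o(\<lambda>N. real N)"
  proof (rule landau_o.big_small_trans)
    show "(\<lambda>N. real (h N)) \<in> O(\<lambda>N. sqrt (real N))"
    proof (rule bigoI[of _ 1], rule always_eventually, rule allI)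
      fix N
      have "(h N) ^ 2 \<le> N" using h_mem[of N] square[of "h N"] by auto
      then have "real (h N) ^ 2 \<le> real N" by (metis of_nat_le_iff of_nat_power)
      then show "norm (real (h N)) \<le> 1 * norm (sqrt (real N))" by (simp add: real_le_rsqrt)
    qed
    show "(\<lambda>N. sqrt (real N)) \<in> o(\<lambda>N. real N)"
      by real_asymp
  qed
  moreover have "g n \<le> N" if "0 < n" "n \<le> h N" for n N
  proof -
    have "g n \<le> (\<Sum>i\<le>h N. g i)" using that by (intro member_le_sum) auto
    also have "\<dots> \<le> G (h N)" by (simp add: G_def)
    also have "\<dots> \<le> N" using h_mem[of N] that by auto
    finally show ?thesis .
  qed
  ultimately show ?thesis by blast
qed

theorem theorem1p3:
  "\<exists>\<epsilon>\<^sub>0 > (0::real). \<exists>h\<^sub>0 :: nat \<Rightarrow> nat.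
     filterlim h\<^sub>0 at_top at_top \<and> (\<lambda>N. real (h\<^sub>0 N)) \<in> o(\<lambda>N. real N) \<and>
     (\<forall>(\<epsilon>::real) (ginv :: nat \<Rightarrow> nat)
        (A :: nat \<Rightarrow> nat \<Rightarrow> nat \<Rightarrow> real \<Rightarrow> seeded_alg)
        (T :: nat \<Rightarrow> real \<Rightarrow> nat)
        (ell :: nat \<Rightarrow> nat \<Rightarrow> nat \<Rightarrow> real \<Rightarrow> nat).
        0 < \<epsilon> \<longrightarrow> \<epsilon> < \<epsilon>\<^sub>0 \<longrightarrow>
        filterlim ginv at_top at_top \<longrightarrow>
        (\<forall>\<^sub>F N in at_top. ginv N \<le> h\<^sub>0 N) \<longrightarrow>
        (\<forall>N n. 3 \<le> n \<longrightarrow> n \<le> N \<longrightarrow>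
           partition_oracle (label_cycles N n) 2 \<epsilon> (T 2 \<epsilon>) (ell N n 2 \<epsilon>) (A N n 2 \<epsilon>)) \<longrightarrow>
        (\<lambda>N. real (ell N (ginv N) 2 \<epsilon>)) \<in> \<omega>(\<lambda>_. 1))"
proof -
  have "\<forall>T l. \<exists>n\<^sub>0. \<forall>n. \<exists>N\<^sub>0. n\<^sub>0 \<le> n \<longrightarrow> (\<forall>N\<ge>N\<^sub>0. \<forall>\<epsilon> A. \<epsilon> < 1/4 \<longrightarrow>
      \<not> partition_oracle (label_cycles N n) 2 \<epsilon> T l A)"
    using no_partition_oracle by meson
  then obtain n\<^sub>0 N\<^sub>0 :: "_ \<Rightarrow> _ \<Rightarrow> _" where no: "\<And>T l n N \<epsilon> A. \<lbrakk>n\<^sub>0 T l \<le> n; N\<^sub>0 T l n \<le> N; \<epsilon> < 1/4\<rbrakk> \<Longrightarrow>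
      \<not> partition_oracle (label_cycles N n) 2 \<epsilon> T l A"
    by metis
  \<comment> \<open>A diagonal bound: \<open>h\<^sub>0\<close> precedes \<open>T\<close> and
    \<open>ell\<close> in the theorem, so \<open>g n\<close> covers all query bounds and seed
    lengths up to \<open>n\<close>. Any fixed pair is covered once \<open>n\<close> is
    large.\<close>
  define g where "g n = n + (\<Sum>T\<le>n. \<Sum>l\<le>n. N\<^sub>0 T l n)" for n
  have g: "n \<le> g n" "T \<le> n \<Longrightarrow> l \<le> n \<Longrightarrow> N\<^sub>0 T l n \<le> g n" for n T l
  proof -
    assume "T \<le> n" "l \<le> n"
    then have "N\<^sub>0 T l n \<le> (\<Sum>l\<le>n. N\<^sub>0 T l n)" by (intro member_le_sum) auto
    also have "\<dots> \<le> (\<Sum>T\<le>n. \<Sum>l\<le>n. N\<^sub>0 T l n)"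
      using \<open>T \<le> n\<close> by (intro member_le_sum[of T "{..n}" "\<lambda>T. \<Sum>l\<le>n. N\<^sub>0 T l n"]) auto
    finally show "N\<^sub>0 T l n \<le> g n" by (simp add: g_def)
  qed (simp add: g_def)
  obtain h\<^sub>0 :: "nat \<Rightarrow> nat" where h0: "filterlim h\<^sub>0 at_top at_top" "(\<lambda>N. real (h\<^sub>0 N)) \<in> o(\<lambda>N. real N)"
    "\<And>N n. 0 < n \<Longrightarrow> n \<le> h\<^sub>0 N \<Longrightarrow> g n \<le> N"
    using ex_slow_inverse[of g] by blast
  show ?thesis
  proof (rule exI[of _ "1/4"], intro conjI exI[of _ h\<^sub>0] h0(1,2) allI impI)
    fix \<epsilon> :: real and ginv :: "nat \<Rightarrow> nat" and A :: "nat \<Rightarrow> nat \<Rightarrow> nat \<Rightarrow> real \<Rightarrow> seeded_alg"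
      and T :: "nat \<Rightarrow> real \<Rightarrow> nat" and ell :: "nat \<Rightarrow> nat \<Rightarrow> nat \<Rightarrow> real \<Rightarrow> nat"
    assume \<epsilon>: "\<epsilon> < 1/4" and ginv: "filterlim ginv at_top at_top" "\<forall>\<^sub>F N in at_top. ginv N \<le> h\<^sub>0 N"
      and po: "\<forall>N n. 3 \<le> n \<longrightarrow> n \<le> N \<longrightarrow>
           partition_oracle (label_cycles N n) 2 \<epsilon> (T 2 \<epsilon>) (ell N n 2 \<epsilon>) (A N n 2 \<epsilon>)"
    show "(\<lambda>N. real (ell N (ginv N) 2 \<epsilon>)) \<in> \<omega>(\<lambda>_. 1)"
    proof (rule landau_omega.smallI)
      fix c :: real
      define L where "L = nat \<lceil>c\<rceil>"
      \<comment> \<open>All seed lengths \<open>l \<le> L\<close> are treated at once, since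
        \<open>ell\<close> may vary with \<open>N\<close>; the \<open>3\<close> is the least length
        of a cycle.\<close>
      define b where "b = 3 + T 2 \<epsilon> + L + (\<Sum>l\<le>L. n\<^sub>0 (T 2 \<epsilon>) l)"
      have "\<forall>\<^sub>F N in at_top. b \<le> ginv N"
        using ginv(1) unfolding filterlim_at_top by blast
      then show "\<forall>\<^sub>F N in at_top. c * norm (1 :: real) \<le> norm (real (ell N (ginv N) 2 \<epsilon>))"
        using ginv(2)
      proof eventually_elim
        fix N assume big: "b \<le> ginv N" and small: "ginv N \<le> h\<^sub>0 N"
        define n l where "n = ginv N" and "l = ell N (ginv N) 2 \<epsilon>"
        have n: "3 \<le> n" "T 2 \<epsilon> \<le> n" "L \<le> n" using big by (auto simp: b_def n_def)
        have gn: "g n \<le> N" using h0(3)[of n N] small n by (simp add: n_def)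
        have "\<not> real l < c"
        proof
          assume "real l < c"
          then have l: "l \<le> L" unfolding L_def by linarith
          then have "n\<^sub>0 (T 2 \<epsilon>) l \<le> (\<Sum>l\<le>L. n\<^sub>0 (T 2 \<epsilon>) l)" by (intro member_le_sum) auto
          then have "n\<^sub>0 (T 2 \<epsilon>) l \<le> n" using big by (simp add: b_def n_def)
          moreover have "N\<^sub>0 (T 2 \<epsilon>) l n \<le> N" using g(2)[of "T 2 \<epsilon>" n l] l n gn by simp
          ultimately have "\<not> partition_oracle (label_cycles N n) 2 \<epsilon> (T 2 \<epsilon>) l (A N n 2 \<epsilon>)"
            using no \<epsilon> by blast
          moreover have "n \<le> N" using g(1)[of n] gn by simp
          ultimately show False using po n(1) by (simp add: n_def l_def)
        qed
        then show "c * norm (1 :: real) \<le> norm (real (ell N (ginv N) 2 \<epsilon>))" by (simp add: l_def)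
      qed
    qed
  qed simp
qed

end
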